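(* Let $m\in\mathbb{N}^*$, $a\in\mathbb{R}$, $I_f\in\mathbb{I}_{a+}$, $\Omega=\mathbb{R}^m$, let $f:\mathbb{R}^m\times I_f\to\mathbb{R}^m$ be a Carathéodory function, let $q_a\in\mathbb{R}^m$ and $\alpha=(\alpha_1,\dots,\alpha_m)\in(0,1]^m$. Assume that: (i) for any compact $K\subset\mathbb{R}^m$ and any $[c,d]\subset I_f$ there exists $M\ge0$ such that $|f(x,t)|_m\le M$ for any $x\in K$ and for almost every $t\in[c,d]$; (ii) for any $[c,d]\subset I_f$ there exists $L\ge0$ such that $|f(x_2,t)-f(x_1,t)|_m\le L|x_2-x_1|_m$ for any $x_1,x_2\in\mathbb{R}^m$ and for almost every $t\in[c,d]$. Then the maximal solution $(q,I)$ of the Cauchy problem $${}_{\mathrm c}\mathrm{D}^\alpha_{a+}[q](t)=f(q(t),t),\qquad q(a)=q_a$$ is global, that is, $I=I_f$.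
   Context: $\mathbb{N}^*$ is the set of positive integers, $|\cdot|_m$ is the Euclidean norm of $\mathbb{R}^m$. For $a\in\mathbb{R}$, $\mathbb{I}_{a+}$ denotes the set of intervals $I\subset\mathbb{R}$ with $\{a\}\subsetneq I\subset[a,+\infty)$ (not necessarily compact). $\mathrm{L}^1_{\mathrm{loc}}(I)$ (resp. $\mathrm{AC}_{\mathrm{loc}}(I)$) is the set of functions on $I$ that are integrable (resp. absolutely continuous) on every compact subinterval of $I$; $\mathrm{C}(I)$ is the set of continuous functions. Left fractional operators. Let $I\in\mathbb{I}_{a+}$ and $q\in \mathrm{L}^1_{\mathrm{loc}}(I,\mathbb{R})$. For a real $\alpha>0$, $\mathrm{I}^\alpha_{a+}[q](t):=\int_a^t\frac{1}{\Gamma(\alpha)}(t-\tau)^{\alpha-1}q(\tau)\,d\tau$ (defined for a.e. $t\in I$), and $\mathrm{I}^0_{a+}[q]:=q$; if $\mathrm{I}^\alpha_{a+}[q]$ is a.e. equal to a continuous function, it is identified with it. For $0\le\alpha\le1$, $\mathrm{AC}^\alpha_{a+}(I,\mathbb{R})$ is the set of $q\in \mathrm{L}^1_{\mathrm{loc}}(I,\mathbb{R})$ with $\mathrm{I}^{1-\alpha}_{a+}[q]\in\mathrm{AC}_{\mathrm{loc}}(I,\mathbb{R})$, and then $\mathrm{D}^\alpha_{a+}[q]:=\frac{d}{dt}\mathrm{I}^{1-\alpha}_{a+}[q]$ a.e. on $I$. ${}_{\mathrm c}\mathrm{AC}^\alpha_{a+}(I,\mathbb{R})$ is the set of $q\in\mathrm{C}(I,\mathbb{R})$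 with $q-q(a)\in\mathrm{AC}^\alpha_{a+}(I,\mathbb{R})$, and then ${}_{\mathrm c}\mathrm{D}^\alpha_{a+}[q]:=\mathrm{D}^\alpha_{a+}[q-q(a)]$. For vector functions $q=(q_i)$ and a multi-order $\alpha=(\alpha_i)$ everything is taken componentwise, the $i$-th component with order $\alpha_i$. A local solution of the Cauchy problem is a couple $(q,I)$ with $I\in\mathbb{I}_{a+}$, $I\subset I_f$, $q\in{}_{\mathrm c}\mathrm{AC}^\alpha_{a+}(I,\mathbb{R}^m)$, $q(a)=q_a$ and ${}_{\mathrm c}\mathrm{D}^\alpha_{a+}[q](t)=f(q(t),t)$ for a.e. $t\in I$. A couple $(q',I')$ is an extension of a local solution $(q,I)$ if $(q',I')$ is a local solution, $I\subset I'$ and $q'=q$ on $I$. A local solution $(q,I)$ is maximal if $I'=I$ for every extension $(q',I')$ of $(q,I)$, and global if $I=I_f$. Under the assumptions of the claim a maximal solution exists and is unique (hypothesis (ii) implies the local Lipschitz continuity of $f$ in its first variable, under which, together with (i), existence and uniqueness of the maximal solution hold); it is "the maximal solution" of the claim. *)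

theory Defs
  imports "HOL-Analysis.Analysis"
begin

definition intervals_from :: "real \<Rightarrow> real set set" where
  "intervals_from a = {I. is_interval I \<and> {a} \<subset> I \<and> I \<subseteq> {a..}}"

definition L1_loc :: "real set \<Rightarrow> (real \<Rightarrow> real) set" where
  "L1_loc I = {q. \<forall>c d. {c..d} \<subseteq> I \<longrightarrow> set_integrable lebesgue {c..d} q}"

text \<open>The classical definition of absolute continuity: a finite family of non-overlapping
  compact subintervals is a division \<open>D\<close> (possibly with degenerate members, which contribute
  nothing to either sum) of its union \<open>S\<close>, and a member \<open>k\<close> has the end points
  \<open>Inf k\<close> and \<open>Sup k\<close>.\<close>

definition abs_continuous_on :: "real set \<Rightarrow> (real \<Rightarrow> real) \<Rightarrow> bool" where
  "abs_continuous_on J u \<longleftrightarrow>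
    (\<forall>\<epsilon>>0. \<exists>\<delta>>0. \<forall>D S. D division_of S \<and> S \<subseteq> J \<and> (\<Sum>k\<in>D. Sup k - Inf k) < \<delta>
       \<longrightarrow> (\<Sum>k\<in>D. \<bar>u (Sup k) - u (Inf k)\<bar>) < \<epsilon>)"

definition AC_loc :: "real set \<Rightarrow> (real \<Rightarrow> real) set" where
  "AC_loc I = {u. \<forall>c d. {c..d} \<subseteq> I \<longrightarrow> abs_continuous_on {c..d} u}"

text \<open>Identification of a function with the continuous function it is almost everywhere equal
  to, if there is one. On a nondegenerate interval \<open>I\<close> the values on \<open>I\<close> of that continuous
  function are unique; its values outside \<open>I\<close> are arbitrary and never used below.\<close>

definition continuous_version :: "real set \<Rightarrow> (real \<Rightarrow> real) \<Rightarrow> real \<Rightarrow> real" where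
  "continuous_version I u =
    (if \<exists>v. continuous_on I v \<and> (AE t in lebesgue_on I. v t = u t)
     then SOME v. continuous_on I v \<and> (AE t in lebesgue_on I. v t = u t)
     else u)"

text \<open>For \<open>\<alpha> > 0\<close> the formula is meaningful only for almost every \<open>t\<close>; the Bochner integral
  takes the value 0 at the remaining points.\<close>

definition frac_integral_pt :: "real \<Rightarrow> real \<Rightarrow> (real \<Rightarrow> real) \<Rightarrow> real \<Rightarrow> real" where
  "frac_integral_pt a \<alpha> q t =
    (if \<alpha> = 0 then q t
     else (LINT \<tau>:{a..t}|lebesgue. 1 / Gamma \<alpha> * (t - \<tau>) powr (\<alpha> - 1) * q \<tau>))"

definition frac_integral :: "real \<Rightarrow> real \<Rightarrow> real set \<Rightarrow> (real \<Rightarrow> real) \<Rightarrow> real \<Rightarrow> real" where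
  "frac_integral a \<alpha> I q = continuous_version I (frac_integral_pt a \<alpha> q)"

text \<open>The Riemann-Liouville space and derivative of order \<open>\<alpha> \<in> [0, 1]\<close>. As the derivative is
  only determined almost everywhere, it is given by a relation: \<open>g\<close> is (a version of) the
  derivative of \<open>q\<close>. For \<open>q\<close> in the space such a \<open>g\<close> exists and is unique up to null sets.\<close>

definition RL_AC :: "real \<Rightarrow> real \<Rightarrow> real set \<Rightarrow> (real \<Rightarrow> real) set" where
  "RL_AC a \<alpha> I = {q \<in> L1_loc I. frac_integral a (1 - \<alpha>) I q \<in> AC_loc I}"

definition has_RL_deriv ::
    "real \<Rightarrow> real \<Rightarrow> real set \<Rightarrow> (real \<Rightarrow> real) \<Rightarrow> (real \<Rightarrow> real) \<Rightarrow> bool" where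
  "has_RL_deriv a \<alpha> I q g \<longleftrightarrow> q \<in> RL_AC a \<alpha> I \<and>
    (AE t in lebesgue_on I.
       (frac_integral a (1 - \<alpha>) I q has_real_derivative g t) (at t within I))"

definition caputo_AC :: "real \<Rightarrow> real \<Rightarrow> real set \<Rightarrow> (real \<Rightarrow> real) set" where
  "caputo_AC a \<alpha> I = {q. continuous_on I q \<and> (\<lambda>t. q t - q a) \<in> RL_AC a \<alpha> I}"

definition has_caputo_deriv ::
    "real \<Rightarrow> real \<Rightarrow> real set \<Rightarrow> (real \<Rightarrow> real) \<Rightarrow> (real \<Rightarrow> real) \<Rightarrow> bool" where
  "has_caputo_deriv a \<alpha> I q g \<longleftrightarrow>
    q \<in> caputo_AC a \<alpha> I \<and> has_RL_deriv a \<alpha> I (\<lambda>t. q t - q a) g"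

definition caratheodory :: "real set \<Rightarrow> ((real ^ 'm) \<times> real \<Rightarrow> real ^ 'm) \<Rightarrow> bool" where
  "caratheodory I\<^sub>f f \<longleftrightarrow>
    (\<forall>x. (\<lambda>t. f (x, t)) \<in> borel_measurable (lebesgue_on I\<^sub>f)) \<and>
    (AE t in lebesgue_on I\<^sub>f. continuous_on UNIV (\<lambda>x. f (x, t)))"

definition local_solution ::
    "real \<Rightarrow> real set \<Rightarrow> ((real ^ 'm) \<times> real \<Rightarrow> real ^ 'm) \<Rightarrow> real ^ 'm \<Rightarrow> real ^ 'm
      \<Rightarrow> (real \<Rightarrow> real ^ 'm) \<Rightarrow> real set \<Rightarrow> bool" where
  "local_solution a I\<^sub>f f \<alpha> q\<^sub>a q I \<longleftrightarrow>
    I \<in> intervals_from a \<and> I \<subseteq> I\<^sub>f \<and>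
    (\<forall>i. (\<lambda>t. q t $ i) \<in> caputo_AC a (\<alpha> $ i) I) \<and>
    q a = q\<^sub>a \<and>
    (\<forall>i. has_caputo_deriv a (\<alpha> $ i) I (\<lambda>t. q t $ i) (\<lambda>t. f (q t, t) $ i))"

definition extends_solution ::
    "real \<Rightarrow> real set \<Rightarrow> ((real ^ 'm) \<times> real \<Rightarrow> real ^ 'm) \<Rightarrow> real ^ 'm \<Rightarrow> real ^ 'm
      \<Rightarrow> (real \<Rightarrow> real ^ 'm) \<Rightarrow> real set \<Rightarrow> (real \<Rightarrow> real ^ 'm) \<Rightarrow> real set \<Rightarrow> bool" where
  "extends_solution a I\<^sub>f f \<alpha> q\<^sub>a q' I' q I \<longleftrightarrow>
    local_solution a I\<^sub>f f \<alpha> q\<^sub>a q' I' \<and> I \<subseteq> I' \<and> (\<forall>t\<in>I. q' t = q t)"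

definition maximal_solution ::
    "real \<Rightarrow> real set \<Rightarrow> ((real ^ 'm) \<times> real \<Rightarrow> real ^ 'm) \<Rightarrow> real ^ 'm \<Rightarrow> real ^ 'm
      \<Rightarrow> (real \<Rightarrow> real ^ 'm) \<Rightarrow> real set \<Rightarrow> bool" where
  "maximal_solution a I\<^sub>f f \<alpha> q\<^sub>a q I \<longleftrightarrow>
    local_solution a I\<^sub>f f \<alpha> q\<^sub>a q I \<and>
    (\<forall>q' I'. extends_solution a I\<^sub>f f \<alpha> q\<^sub>a q' I' q I \<longrightarrow> I' = I)"

text \<open>The couple \<open>(q, I)\<close> is the only maximal solution; \<open>q\<close> is a function on \<open>I\<close>, so its values
  elsewhere do not count.\<close>

definition the_maximal_solution ::
    "real \<Rightarrow> real set \<Rightarrow> ((real ^ 'm) \<times> real \<Rightarrow> real ^ 'm) \<Rightarrow> real ^ 'm \<Rightarrow> real ^ 'm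
      \<Rightarrow> (real \<Rightarrow> real ^ 'm) \<Rightarrow> real set \<Rightarrow> bool" where
  "the_maximal_solution a I\<^sub>f f \<alpha> q\<^sub>a q I \<longleftrightarrow>
    maximal_solution a I\<^sub>f f \<alpha> q\<^sub>a q I \<and>
    (\<forall>q' I'. maximal_solution a I\<^sub>f f \<alpha> q\<^sub>a q' I' \<longrightarrow> I' = I \<and> (\<forall>t\<in>I. q' t = q t))"

definition global_solution ::
    "real \<Rightarrow> real set \<Rightarrow> ((real ^ 'm) \<times> real \<Rightarrow> real ^ 'm) \<Rightarrow> real ^ 'm \<Rightarrow> real ^ 'm
      \<Rightarrow> (real \<Rightarrow> real ^ 'm) \<Rightarrow> real set \<Rightarrow> bool" where
  "global_solution a I\<^sub>f f \<alpha> q\<^sub>a q I \<longleftrightarrow> local_solution a I\<^sub>f f \<alpha> q\<^sub>a q I \<and> I = I\<^sub>f"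

end

theory Submission
  imports Defs
begin

text \<open>For continuous \<open>q\<close>, the Cauchy problem is equivalent to the Volterra equation whose
  \<open>i\<close>-th component says that \<open>q\<^sub>i\<close> is its initial value plus the fractional integral of order
  \<open>\<alpha>\<^sub>i\<close> of \<open>f\<^sub>i(q(t), t)\<close>, by the semigroup property of the fractional integrals (Fubini and the
  Beta integral), Lebesgue differentiation and the fundamental theorem of calculus for absolutely
  continuous functions. Since \<open>f\<close> is globally Lipschitz in its first variable, the Volterra
  operator is a contraction on every compact interval \<open>[a, b] \<subseteq> I\<^sub>f\<close> for a suitable exponentially
  weighted sup norm. Hence the Picard iterates converge on the whole of \<open>I\<^sub>f\<close> to a global
  solution, and every local solution is a restriction of it.\<close>

section \<open>The fractional kernel and convolution with it\<close>

text \<open>The delicate half of the equivalence recovers \<open>q\<close> from the integral of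
  order \<open>1 - \<alpha>\<close> of \<open>q - q(a)\<close>. A further integral of order \<alpha>
  turns both sides into integrals of order 1, which Lebesgue differentiation inverts almost
  everywhere and continuity then everywhere. So that Fubini needs no moving domains, fractional
  integrals are rewritten as convolutions over the whole line: the kernel vanishes for
  \<open>x \<le> 0\<close>, and the other factor is a bounded Borel function vanishing before
  \<open>a\<close>. The other obstacle is null sets. The exceptional times in the hypotheses depend
  on the points and on the compact interval, whereas composition with an unknown \<open>q\<close>
  calls for one null set that serves all points. It is assembled from a countable dense set of
  points and a countable cofinal set of times. Resetting \<open>f\<close> to 0 at those times gives
  estimates valid everywhere and leaves the local solutions unchanged.\<close>

definition frac_kernel :: "real \<Rightarrow> real \<Rightarrow> real" where
  "frac_kernel \<alpha> x = (if 0 < x then x powr (\<alpha> - 1) / Gamma \<alpha> else 0)"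

lemma frac_kernel_measurable [measurable]: "frac_kernel \<alpha> \<in> borel_measurable borel"
  unfolding frac_kernel_def by measurable

lemma frac_kernel_nonneg: "0 < \<alpha> \<Longrightarrow> 0 \<le> frac_kernel \<alpha> x"
  by (simp add: frac_kernel_def Gamma_real_nonneg)

lemma frac_kernel_nonpos [simp]: "x \<le> 0 \<Longrightarrow> frac_kernel \<alpha> x = 0"
  by (simp add: frac_kernel_def)

lemma frac_kernel_1: "frac_kernel 1 x = (if 0 < x then 1 else 0)"
  by (simp add: frac_kernel_def)

lemma frac_kernel_antimono:
  assumes "0 < \<alpha>" "\<alpha> \<le> 1" "0 < x" "x \<le> y"
  shows "frac_kernel \<alpha> y \<le> frac_kernel \<alpha> x"
  using assms by (auto simp: frac_kernel_def intro!: divide_right_mono powr_mono2' Gamma_real_nonneg)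

lemma frac_kernel_mono:
  assumes "1 \<le> \<alpha>" "x \<le> y"
  shows "frac_kernel \<alpha> x \<le> frac_kernel \<alpha> y"
  using assms by (auto simp: frac_kernel_def intro!: divide_right_mono powr_mono2 Gamma_real_nonneg)

text \<open>The semigroup law at the level of kernels. The substitution
  \<open>s = r + (t - r) * x\<close> produces Euler's Beta integral, whose Gamma factors cancel
  those of the two kernels. The nonnegative integral gives the value and the integrability at
  once.\<close>

lemma nn_integral_frac_kernel_conv:
  assumes b: "0 < \<beta>" and g: "0 < \<gamma>"
  shows "(\<integral>\<^sup>+s. ennreal (frac_kernel \<beta> (t - s) * frac_kernel \<gamma> (s - r)) \<partial>lborel)
    = ennreal (frac_kernel (\<beta> + \<gamma>) (t - r))"
proof (cases "r < t")
  case False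
  then have zero: "frac_kernel \<beta> (t - s) * frac_kernel \<gamma> (s - r) = 0" for s
    by (auto simp: frac_kernel_def)
  show ?thesis unfolding zero using False by simp
next
  case True
  define c where "c = t - r"
  have c: "0 < c" using True by (simp add: c_def)
  \<comment> \<open>The two kernels contribute the powers \<open>\<beta> - 1\<close> and
    \<open>\<gamma> - 1\<close> of \<open>c\<close>; the Jacobian \<open>c\<close> of the
    substitution later supplies the one still missing for order
    \<open>\<beta> + \<gamma>\<close>.\<close>
  define C where "C = c powr (\<beta> + \<gamma> - 2) / (Gamma \<beta> * Gamma \<gamma>)"
  have C0: "0 \<le> C" using b g by (simp add: C_def Gamma_real_nonneg)
  have eq: "frac_kernel \<beta> (t - (r + c * x)) * frac_kernel \<gamma> ((r + c * x) - r) =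
    C * (indicator {0..1} x * (x powr (\<gamma> - 1) * (1 - x) powr (\<beta> - 1)))" for x
  proof -
    have 1: "t - (r + c * x) = c * (1 - x)" by (simp add: c_def algebra_simps)
    show ?thesis
    proof (cases "0 < x \<and> x < 1")
      case True
      have "c powr (\<beta> - 1) * c powr (\<gamma> - 1) = c powr (\<beta> + \<gamma> - 2)"
        by (simp add: powr_add[symmetric])
      moreover have "frac_kernel \<beta> (c * (1 - x)) = c powr (\<beta> - 1) * (1 - x) powr (\<beta> - 1) / Gamma \<beta>"
        "frac_kernel \<gamma> (c * x) = c powr (\<gamma> - 1) * x powr (\<gamma> - 1) / Gamma \<gamma>"
        using True c by (auto simp: frac_kernel_def powr_mult)
      ultimately show ?thesis
        using True unfolding 1 by (simp add: C_def field_simps)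
    next
      \<comment> \<open>At \<open>x = 0\<close> and \<open>x = 1\<close> both sides are 0 because
        \<open>0 powr y = 0\<close> for every \<open>y\<close>, including \<open>y = 0\<close>; this
        matches the value 0 of the kernel at 0.\<close>
      case False
      then have "x \<le> 0 \<or> 1 \<le> x" by auto
      then have "frac_kernel \<beta> (c * (1 - x)) * frac_kernel \<gamma> (c * x) = 0"
        using c by (auto simp: frac_kernel_def zero_less_mult_iff)
      then show ?thesis using False unfolding 1 by (auto simp: indicator_def)
    qed
  qed
  have "(\<integral>\<^sup>+s. ennreal (frac_kernel \<beta> (t - s) * frac_kernel \<gamma> (s - r)) \<partial>lborel)
    = ennreal \<bar>c\<bar> * (\<integral>\<^sup>+x. ennreal (frac_kernel \<beta> (t - (r + c * x)) * frac_kernel \<gamma> ((r + c * x) - r)) \<partial>lborel)"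
    using c by (intro nn_integral_real_affine) auto
  also have "(\<integral>\<^sup>+x. ennreal (frac_kernel \<beta> (t - (r + c * x)) * frac_kernel \<gamma> ((r + c * x) - r)) \<partial>lborel)
    = (\<integral>\<^sup>+x. ennreal C * ennreal (indicator {0..1} x * (x powr (\<gamma> - 1) * (1 - x) powr (\<beta> - 1))) \<partial>lborel)"
    by (intro nn_integral_cong) (simp only: eq ennreal_mult'[OF C0])
  also have "\<dots> = ennreal C * ennreal (Beta \<gamma> \<beta>)"
    using nn_integral_has_integral_lebesgue[OF _ has_integral_Beta_real[OF g b]]
    by (subst nn_integral_cmult) auto
  also have "ennreal \<bar>c\<bar> * \<dots> = ennreal (c * (C * Beta \<gamma> \<beta>))"
    by (simp only: abs_of_pos[OF c] ennreal_mult'[OF C0] ennreal_mult'[OF less_imp_le[OF c]])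
  also have "c * (C * Beta \<gamma> \<beta>) = frac_kernel (\<beta> + \<gamma>) (t - r)"
  proof -
    have "c * c powr (\<beta> + \<gamma> - 2) = c powr (\<beta> + \<gamma> - 1)"
      using c by (simp add: powr_mult_base)
    then show ?thesis
      using c b g by (simp add: C_def Beta_def frac_kernel_def c_def[symmetric] Gamma_eq_zero_iff
        nonpos_Ints_def add.commute field_simps)
  qed
  finally show ?thesis .
qed

lemma frac_kernel_conv:
  assumes "0 < \<beta>" "0 < \<gamma>"
  shows "has_bochner_integral lborel (\<lambda>s. frac_kernel \<beta> (t - s) * frac_kernel \<gamma> (s - r))
    (frac_kernel (\<beta> + \<gamma>) (t - r))"
  using nn_integral_frac_kernel_conv[OF assms, of t r] assms
  by (intro has_bochner_integral_nn_integral AE_I2 mult_nonneg_nonneg frac_kernel_nonneg) auto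

text \<open>The Laplace transform of the kernel: the Gamma integral rescaled by \<open>k\<close>.
  Its value is the origin of the contraction factor.\<close>

lemma nn_integral_frac_kernel_exp:
  assumes al: "0 < \<alpha>" and k: "0 < k"
  shows "(\<integral>\<^sup>+x. ennreal (frac_kernel \<alpha> x * exp (- k * x)) \<partial>lborel) = ennreal (k powr (- \<alpha>))"
proof -
  have eq: "k powr (-\<alpha>) / Gamma \<alpha> * (indicator {0..} (k * x) * (k * x) powr (\<alpha> - 1) / exp (k * x)) = frac_kernel \<alpha> x * exp (- k * x) / k" for x
  proof (cases "0 < x")
    case True
    have "k powr (-\<alpha>) * k powr (\<alpha> - 1) = inverse k"
      using k by (simp add: powr_diff powr_minus_divide inverse_eq_divide)
    have "k powr (-\<alpha>) / Gamma \<alpha> * (indicator {0..} (k * x) * (k * x) powr (\<alpha> - 1) / exp (k * x))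
      = (k powr (-\<alpha>) * k powr (\<alpha> - 1)) * (x powr (\<alpha> - 1) / Gamma \<alpha> * inverse (exp (k * x)))"
      using True k by (simp add: powr_mult divide_inverse mult_ac)
    also have "\<dots> = frac_kernel \<alpha> x * exp (- k * x) / k"
      unfolding \<open>k powr (-\<alpha>) * k powr (\<alpha> - 1) = inverse k\<close>
      using True by (simp add: frac_kernel_def exp_minus divide_inverse mult_ac)
    finally show ?thesis .
  qed (use k in \<open>auto simp: indicator_def zero_le_mult_iff\<close>)
  have "(\<integral>\<^sup>+x. ennreal (frac_kernel \<alpha> x * exp (- k * x)) \<partial>lborel)
    = (\<integral>\<^sup>+x. ennreal k * (ennreal (k powr (-\<alpha>) / Gamma \<alpha>) * ennreal (indicator {0..} (k * x) * (k * x) powr (\<alpha> - 1) / exp (k * x))) \<partial>lborel)"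
  proof (intro nn_integral_cong)
    fix x
    have nn: "0 \<le> k powr (-\<alpha>) / Gamma \<alpha>"
      using al by (simp add: Gamma_real_nonneg)
    have "ennreal k * (ennreal (k powr (-\<alpha>) / Gamma \<alpha>) * ennreal (indicator {0..} (k * x) * (k * x) powr (\<alpha> - 1) / exp (k * x)))
      = ennreal (k * (k powr (-\<alpha>) / Gamma \<alpha> * (indicator {0..} (k * x) * (k * x) powr (\<alpha> - 1) / exp (k * x))))"
      using k al by (simp only: ennreal_mult'[OF less_imp_le[OF k]] ennreal_mult'[OF nn])
    also have "\<dots> = ennreal (frac_kernel \<alpha> x * exp (- k * x))"
      unfolding eq using k by simp
    finally show "ennreal (frac_kernel \<alpha> x * exp (- k * x)) = ennreal k * (ennreal (k powr (-\<alpha>) / Gamma \<alpha>) * ennreal (indicator {0..} (k * x) * (k * x) powr (\<alpha> - 1) / exp (k * x)))" by simp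
  qed
  also have "\<dots> = ennreal (k powr (-\<alpha>) / Gamma \<alpha>) * (ennreal k * (\<integral>\<^sup>+x. ennreal (indicator {0..} (0 + k * x) * (0 + k * x) powr (\<alpha> - 1) / exp (0 + k * x)) \<partial>lborel))"
    by (simp add: nn_integral_cmult mult_ac)
  also have "ennreal k * (\<integral>\<^sup>+x. ennreal (indicator {0..} (0 + k * x) * (0 + k * x) powr (\<alpha> - 1) / exp (0 + k * x)) \<partial>lborel) = ennreal (Gamma \<alpha>)"
    unfolding Gamma_conv_nn_integral_real[OF al] using k
    by (subst (2) nn_integral_real_affine[where c=k and t=0]) auto
  also have "ennreal (k powr (-\<alpha>) / Gamma \<alpha>) * ennreal (Gamma \<alpha>) = ennreal (k powr (-\<alpha>))"
    using al Gamma_real_pos[OF al] by (simp add: less_imp_neq[THEN not_sym] flip: ennreal_mult'')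
  finally show ?thesis .
qed

text \<open>Since the integral runs over all \<open>s < t\<close> and not only from \<open>a\<close>
  on, the exponential is an exact eigenfunction of the convolution, with the Laplace transform as
  eigenvalue.\<close>

lemma frac_kernel_exp:
  assumes al: "0 < \<alpha>" and k: "0 < k"
  shows "has_bochner_integral lborel (\<lambda>s. frac_kernel \<alpha> (t - s) * exp (k * (s - a))) (exp (k * (t - a)) * k powr (- \<alpha>))"
proof -
  have "has_bochner_integral lborel (\<lambda>x. frac_kernel \<alpha> x * exp (- k * x)) (k powr (- \<alpha>))"
    using nn_integral_frac_kernel_exp[OF assms] assms
    by (intro has_bochner_integral_nn_integral AE_I2 mult_nonneg_nonneg frac_kernel_nonneg) auto
  then have "has_bochner_integral lborel (\<lambda>s. exp (k * (t - a)) * (frac_kernel \<alpha> (t + (-1) * s) * exp (- k * (t + (-1) * s)))) (exp (k * (t - a)) * k powr (- \<alpha>))"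
    by (subst (asm) lborel_has_bochner_integral_real_affine_iff[where c="-1" and t=t])
       (auto intro!: has_bochner_integral_mult_right)
  then show ?thesis
    by (rule has_bochner_integral_cong[THEN iffD1, rotated -1]) (auto simp: mult_exp_exp algebra_simps simp flip: exp_add)
qed

text \<open>Neither \<open>a\<close> nor an interval appears: the kernel cuts the integral off at
  \<open>t\<close>, and a function vanishing before \<open>a\<close> cuts it off at
  \<open>a\<close>.\<close>

definition frac_conv :: "real \<Rightarrow> (real \<Rightarrow> real) \<Rightarrow> real \<Rightarrow> real" where
  "frac_conv \<alpha> h t = (LINT s|lborel. frac_kernel \<alpha> (t - s) * h s)"

lemma frac_conv_measurable [measurable]:
  assumes [measurable]: "h \<in> borel_measurable borel"
  shows "frac_conv \<alpha> h \<in> borel_measurable borel"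
  unfolding frac_conv_def by measurable

lemma frac_conv_cong:
  assumes "\<And>s. s < t \<Longrightarrow> h s = h' s"
  shows "frac_conv \<alpha> h t = frac_conv \<alpha> h' t"
  unfolding frac_conv_def
proof (rule Bochner_Integration.integral_cong)
  show "frac_kernel \<alpha> (t - s) * h s = frac_kernel \<alpha> (t - s) * h' s" for s
    using assms[of s] by (cases "s < t") auto
qed simp

lemma frac_conv_before:
  assumes "\<And>s. s < a \<Longrightarrow> h s = 0" "t \<le> a"
  shows "frac_conv \<alpha> h t = 0"
  using frac_conv_cong[of t h "\<lambda>_. 0" \<alpha>] assms by (simp add: frac_conv_def)

lemma frac_conv_integrable:
  assumes [measurable]: "h \<in> borel_measurable borel" and M: "\<And>s. \<bar>h s\<bar> \<le> M"
    and h0: "\<And>s. s < a \<Longrightarrow> h s = 0" and al: "0 < \<alpha>"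
  shows "integrable lborel (\<lambda>s. frac_kernel \<alpha> (t - s) * h s)"
proof (rule Bochner_Integration.integrable_bound)
  \<comment> \<open>The kernel of order 1 is the indicator of the positive reals, so the last factor
    selects \<open>s > a - 1\<close>. The shift by 1 keeps the point \<open>s = a\<close> inside,
    and the majorant works at every \<open>s\<close>.\<close>
  show "integrable lborel (\<lambda>s. M * (frac_kernel \<alpha> (t - s) * frac_kernel 1 (s - (a - 1))))"
    using frac_kernel_conv[OF al, of 1 t "a - 1"] by (auto simp: has_bochner_integral_iff)
  show "AE s in lborel. norm (frac_kernel \<alpha> (t - s) * h s) \<le> norm (M * (frac_kernel \<alpha> (t - s) * frac_kernel 1 (s - (a - 1))))"
  proof (rule AE_I2)
    fix s
    show "norm (frac_kernel \<alpha> (t - s) * h s) \<le> norm (M * (frac_kernel \<alpha> (t - s) * frac_kernel 1 (s - (a - 1))))"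
    proof (cases "s < a")
      case False
      have "\<bar>h s\<bar> \<le> \<bar>M\<bar>" using M[of s] by linarith
      then show ?thesis using False frac_kernel_nonneg[OF al, of "t - s"]
        by (simp add: frac_kernel_1 abs_mult mult.commute[of "frac_kernel _ _"] mult_right_mono)
    qed (simp add: h0)
  qed
qed simp

text \<open>Fubini. Integrability in the plane is checked by integrating the norm in
  \<open>s\<close> first: the kernel identity leaves the kernel of order
  \<open>\<beta> + \<gamma>\<close> against \<open>\<bar>h\<bar>\<close>.\<close>

lemma frac_conv_frac_conv:
  assumes [measurable]: "h \<in> borel_measurable borel" and M: "\<And>s. \<bar>h s\<bar> \<le> M"
    and h0: "\<And>s. s < a \<Longrightarrow> h s = 0" and b: "0 < \<beta>" and g: "0 < \<gamma>"
  shows "frac_conv \<beta> (frac_conv \<gamma> h) t = frac_conv (\<beta> + \<gamma>) h t"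
proof -
  define F where "F = (\<lambda>(r, s). frac_kernel \<beta> (t - s) * frac_kernel \<gamma> (s - r) * h r)"
  have Fm [measurable]: "F \<in> borel_measurable (lborel \<Otimes>\<^sub>M lborel)"
    unfolding F_def by measurable
  have hb: "has_bochner_integral lborel (\<lambda>s. frac_kernel \<beta> (t - s) * frac_kernel \<gamma> (s - r) * c) (frac_kernel (\<beta> + \<gamma>) (t - r) * c)" for r c
    by (rule has_bochner_integral_mult_left) (rule frac_kernel_conv[OF b g])
  have nrm: "norm (F (r, s)) = frac_kernel \<beta> (t - s) * frac_kernel \<gamma> (s - r) * \<bar>h r\<bar>" for r s
    using frac_kernel_nonneg[OF b] frac_kernel_nonneg[OF g] by (simp add: F_def abs_mult)
  have F: "integrable (lborel \<Otimes>\<^sub>M lborel) F"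
  proof (rule lborel_pair.Fubini_integrable)
    have "integrable lborel (\<lambda>r. frac_kernel (\<beta> + \<gamma>) (t - r) * \<bar>h r\<bar>)"
      by (rule frac_conv_integrable[where M=M and a=a]) (use M h0 b g in auto)
    then show "integrable lborel (\<lambda>r. \<integral>s. norm (F (r, s)) \<partial>lborel)"
      unfolding nrm using hb by (simp only: has_bochner_integral_iff)
    show "AE r in lborel. integrable lborel (\<lambda>s. F (r, s))"
      using hb by (simp add: F_def has_bochner_integral_iff)
  qed measurable
  have "frac_conv \<beta> (frac_conv \<gamma> h) t = (LINT s|lborel. LINT r|lborel. F (r, s))"
    unfolding frac_conv_def F_def
    by (intro Bochner_Integration.integral_cong refl) (simp add: mult.assoc)
  also have "\<dots> = (LINT r|lborel. LINT s|lborel. F (r, s))"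
    using lborel_pair.Fubini_integral[of "\<lambda>r s. F (r, s)"] F by simp
  also have "\<dots> = frac_conv (\<beta> + \<gamma>) h t"
    unfolding frac_conv_def F_def using hb by (simp only: has_bochner_integral_iff prod.case)
  finally show ?thesis .
qed

lemma frac_conv_exp_bound:
  assumes [measurable]: "h \<in> borel_measurable borel" and al: "0 < \<alpha>" and k: "0 < k"
    and A: "\<And>s. s < t \<Longrightarrow> \<bar>h s\<bar> \<le> A * exp (k * (s - a))"
  shows "\<bar>frac_conv \<alpha> h t\<bar> \<le> A * k powr (- \<alpha>) * exp (k * (t - a))"
proof -
  have hb: "has_bochner_integral lborel (\<lambda>s. A * (frac_kernel \<alpha> (t - s) * exp (k * (s - a)))) (A * (exp (k * (t - a)) * k powr (- \<alpha>)))"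
    by (intro has_bochner_integral_mult_right frac_kernel_exp al k)
  have "\<bar>frac_kernel \<alpha> (t - s) * h s\<bar> \<le> A * (frac_kernel \<alpha> (t - s) * exp (k * (s - a)))" for s
    using A[of s] frac_kernel_nonneg[OF al, of "t - s"] mult_left_mono[OF A[of s], of "frac_kernel \<alpha> (t - s)"]
    by (cases "s < t") (auto simp: abs_mult mult_ac)
  note le = this
  have "\<bar>frac_conv \<alpha> h t\<bar> \<le> (LINT s|lborel. A * (frac_kernel \<alpha> (t - s) * exp (k * (s - a))))"
    unfolding frac_conv_def using hb
    by (intro order_trans[OF integral_abs_bound] integral_mono' le order_trans[OF abs_ge_zero le])
       (simp only: has_bochner_integral_iff)
  also have "\<dots> = A * k powr (- \<alpha>) * exp (k * (t - a))"
    using hb by (simp add: has_bochner_integral_iff mult_ac)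
  finally show ?thesis .
qed

text \<open>For \<alpha> at most 1 the kernel decreases on the positive reals, so the sign of the
  kernel difference is known before and after \<open>t\<close>, and its absolute value can be
  integrated exactly.\<close>

lemma frac_conv_diff_bound:
  assumes [measurable]: "h \<in> borel_measurable borel" and M: "\<And>s. \<bar>h s\<bar> \<le> M"
    and h0: "\<And>s. s < a \<Longrightarrow> h s = 0" and al: "0 < \<alpha>" "\<alpha> \<le> 1" and t: "t \<le> t'"
  shows "\<bar>frac_conv \<alpha> h t' - frac_conv \<alpha> h t\<bar> \<le> 2 * M * frac_kernel (\<alpha> + 1) (t' - t)"
proof -
  \<comment> \<open>\<open>B\<close> is a combination of kernel products, so its integral comes from
    the semigroup law. For \<open>s > t\<close> the second term has the wrong sign; the coefficient
    2 corrects it to a net contribution of +1. The factors of order 1 vanish at \<open>s = a\<close>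
    and \<open>s = t\<close>, which is why these points are set aside.\<close>
  define B where "B s = M * (frac_kernel \<alpha> (t - s) * frac_kernel 1 (s - a) -
    frac_kernel \<alpha> (t' - s) * frac_kernel 1 (s - a) + 2 * (frac_kernel \<alpha> (t' - s) * frac_kernel 1 (s - t)))" for s
  have M0: "0 \<le> M" using M[of 0] by linarith
  note int = frac_conv_integrable[OF assms(1) M h0 al(1)]
  have hb: "has_bochner_integral lborel B (M * (frac_kernel (\<alpha> + 1) (t - a) - frac_kernel (\<alpha> + 1) (t' - a) + 2 * frac_kernel (\<alpha> + 1) (t' - t)))"
    unfolding B_def using al by (intro has_bochner_integral_mult_right has_bochner_integral_add has_bochner_integral_diff frac_kernel_conv) auto
  have le: "\<bar>frac_kernel \<alpha> (t' - s) * h s - frac_kernel \<alpha> (t - s) * h s\<bar> \<le> B s" if "s \<noteq> a" "s \<noteq> t" for s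
  proof (cases "s < a")
    case True
    then show ?thesis using h0[of s] M0 frac_kernel_nonneg[OF al(1)] frac_kernel_nonneg[of 1]
      by (simp add: B_def)
  next
    case False
    have "\<bar>frac_kernel \<alpha> (t' - s) - frac_kernel \<alpha> (t - s)\<bar> * \<bar>h s\<bar> \<le> \<bar>frac_kernel \<alpha> (t' - s) - frac_kernel \<alpha> (t - s)\<bar> * M"
      by (intro mult_left_mono M) auto
    also have "\<bar>frac_kernel \<alpha> (t' - s) - frac_kernel \<alpha> (t - s)\<bar> * M = B s"
    proof (cases "s < t")
      case True
      then have "frac_kernel \<alpha> (t' - s) \<le> frac_kernel \<alpha> (t - s)"
        using t al by (intro frac_kernel_antimono) auto
      then show ?thesis using True False that by (simp add: B_def frac_kernel_1)
    next
      case False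
      then show ?thesis using \<open>\<not> s < a\<close> that frac_kernel_nonneg[OF al(1), of "t' - s"]
        by (simp add: B_def frac_kernel_1)
    qed
    finally show ?thesis by (simp add: abs_mult left_diff_distrib[symmetric])
  qed
  have "\<bar>frac_conv \<alpha> h t' - frac_conv \<alpha> h t\<bar> = \<bar>LINT s|lborel. frac_kernel \<alpha> (t' - s) * h s - frac_kernel \<alpha> (t - s) * h s\<bar>"
    unfolding frac_conv_def by (subst Bochner_Integration.integral_diff) (auto intro: int)
  also have "\<dots> \<le> (LINT s|lborel. \<bar>frac_kernel \<alpha> (t' - s) * h s - frac_kernel \<alpha> (t - s) * h s\<bar>)"
    by (rule integral_abs_bound)
  also have "\<dots> \<le> integral\<^sup>L lborel B"
  proof (rule integral_mono_AE)
    show "AE s in lborel. \<bar>frac_kernel \<alpha> (t' - s) * h s - frac_kernel \<alpha> (t - s) * h s\<bar> \<le> B s"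
      using AE_lborel_singleton[of a] AE_lborel_singleton[of t] by eventually_elim (rule le)
  qed (use hb int in \<open>auto simp: has_bochner_integral_iff\<close>)
  \<comment> \<open>Kernels of order at least 1 increase, so the first two terms of the integral of
    \<open>B\<close> have a nonpositive sum and are dropped.\<close>
  also have "\<dots> \<le> M * (2 * frac_kernel (\<alpha> + 1) (t' - t))"
    using hb M0 frac_kernel_mono[of "\<alpha> + 1" "t - a" "t' - a"] t al
    by (auto simp: has_bochner_integral_iff intro!: mult_left_mono)
  finally show ?thesis by (simp add: mult_ac)
qed

lemma frac_conv_continuous:
  assumes [measurable]: "h \<in> borel_measurable borel" and M: "\<And>s. \<bar>h s\<bar> \<le> M"
    and h0: "\<And>s. s < a \<Longrightarrow> h s = 0" and al: "0 < \<alpha>" "\<alpha> \<le> 1"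
  shows "continuous_on UNIV (frac_conv \<alpha> h)"
proof -
  \<comment> \<open>The kernel of order \<open>\<alpha> + 1\<close> extended to an even function: a
    Hoelder modulus of exponent \<alpha> that serves both signs of \<open>s - t\<close> and is 0 at
    0.\<close>
  define G where "G x = 2 * M * (\<bar>x\<bar> powr \<alpha> / Gamma (\<alpha> + 1))" for x :: real
  have G: "2 * M * frac_kernel (\<alpha> + 1) x \<le> G x" if "0 \<le> x" for x
    using that by (auto simp: frac_kernel_def G_def)
  have step: "\<bar>frac_conv \<alpha> h s - frac_conv \<alpha> h t\<bar> \<le> 2 * M * frac_kernel (\<alpha> + 1) (s - t)" if "t \<le> s" for s t
    using assms that by (rule frac_conv_diff_bound)
  have bound: "\<bar>frac_conv \<alpha> h s - frac_conv \<alpha> h t\<bar> \<le> G (s - t)" for s t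
  proof (cases "t \<le> s")
    case True
    then show ?thesis
      using step[of t s] G[of "s - t"] by linarith
  next
    case False
    then show ?thesis
      using step[of s t] G[of "t - s"] by (simp add: abs_minus_commute G_def)
  qed
  show ?thesis
    unfolding continuous_on_def
  proof
    fix t :: real
    have "(G \<longlongrightarrow> G 0) (nhds 0)"
    proof -
      have "continuous_on UNIV (\<lambda>x::real. \<bar>x\<bar> powr \<alpha>)"
        using al by (intro continuous_on_powr' continuous_intros) auto
      then have "continuous_on UNIV G"
        unfolding G_def divide_inverse by (intro continuous_on_mult continuous_on_const)
      then show ?thesis
        by (simp add: continuous_on_eq_continuous_at continuous_at_imp_continuous_at_within isCont_def tendsto_at_iff_tendsto_nhds)
    qed
    moreover have "((\<lambda>s. s - t) \<longlongrightarrow> 0) (at t)"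
      using LIM_zero by (intro tendsto_eq_intros) auto
    ultimately have "((\<lambda>s. G (s - t)) \<longlongrightarrow> G 0) (at t)"
      by (rule filterlim_compose)
    then have "((\<lambda>s. G (s - t)) \<longlongrightarrow> 0) (at t)"
      by (simp add: G_def)
    then have "((\<lambda>s. frac_conv \<alpha> h s - frac_conv \<alpha> h t) \<longlongrightarrow> 0) (at t)"
      by (rule Lim_null_comparison[rotated]) (use bound in auto)
    then show "(frac_conv \<alpha> h \<longlongrightarrow> frac_conv \<alpha> h t) (at t within UNIV)"
      using LIM_zero_cancel by auto
  qed
qed

section \<open>Absolute continuity and Lebesgue differentiation\<close>

lemma division_endpoints:
  fixes S :: "real set"
  assumes D: "D division_of S" and k: "k \<in> D"
  shows "Inf k \<in> S" "Sup k \<in> S" "Inf k \<le> Sup k" "measure lebesgue k = Sup k - Inf k"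
proof -
  from division_ofD(3,4)[OF D k] obtain u v where uv: "k = {u..v}" "u \<le> v"
    by (metis atLeastatMost_empty_iff2 box_real(2))
  then have "{u, v} \<subseteq> S" using division_ofD(2)[OF D k] by auto
  then show "Inf k \<in> S" "Sup k \<in> S" "Inf k \<le> Sup k" "measure lebesgue k = Sup k - Inf k"
    using uv by auto
qed

lemma division_sum_lengths:
  assumes D: "D division_of S"
  shows "(\<Sum>k\<in>D. Sup k - Inf k) = measure lebesgue (S :: real set)"
  using content_division[OF D] division_endpoints(4)[OF D] by simp

lemma abs_continuous_on_Lipschitz:
  assumes "\<And>x y. x \<in> J \<Longrightarrow> y \<in> J \<Longrightarrow> x \<le> y \<Longrightarrow> \<bar>u y - u x\<bar> \<le> M * (y - x)"
  shows "abs_continuous_on J u"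
  unfolding abs_continuous_on_def
proof (intro allI impI)
  fix e :: real assume e: "0 < e"
  define M' where "M' = \<bar>M\<bar> + 1"
  have M': "0 < M'" "M \<le> M'" by (auto simp: M'_def)
  show "\<exists>\<delta>>0. \<forall>D S. D division_of S \<and> S \<subseteq> J \<and> (\<Sum>k\<in>D. Sup k - Inf k) < \<delta>
       \<longrightarrow> (\<Sum>k\<in>D. \<bar>u (Sup k) - u (Inf k)\<bar>) < e"
  proof (intro exI[of _ "e / M'"] conjI allI impI)
    show "0 < e / M'" using e M' by simp
    fix D S assume A: "D division_of S \<and> S \<subseteq> J \<and> (\<Sum>k\<in>D. Sup k - Inf k) < e / M'"
    have "\<bar>u (Sup k) - u (Inf k)\<bar> \<le> M' * (Sup k - Inf k)" if k: "k \<in> D" for k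
    proof -
      have "Inf k \<in> J" "Sup k \<in> J" "Inf k \<le> Sup k" using A division_endpoints(1-3)[OF _ k, of S] by auto
      then show ?thesis using assms[of "Inf k" "Sup k"] mult_right_mono[OF M'(2), of "Sup k - Inf k"] by simp
    qed
    then have "(\<Sum>k\<in>D. \<bar>u (Sup k) - u (Inf k)\<bar>) \<le> (\<Sum>k\<in>D. M' * (Sup k - Inf k))"
      by (rule sum_mono)
    also have "\<dots> = M' * (\<Sum>k\<in>D. Sup k - Inf k)"
      by (simp add: sum_distrib_left)
    also have "\<dots> < e"
      using A M' by (simp add: pos_less_divide_eq mult.commute)
    finally show "(\<Sum>k\<in>D. \<bar>u (Sup k) - u (Inf k)\<bar>) < e" .
  qed
qed

text \<open>At tags outside \<open>N\<close> the gauge comes from differentiability; tags in \<open>N\<close> are confined to an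
  open set of small measure, where absolute continuity bounds the increments of \<open>w\<close>.\<close>

lemma abs_continuous_on_FTC:
  fixes w g :: "real \<Rightarrow> real"
  assumes ab: "a \<le> b" and ac: "abs_continuous_on {a..b} w" and N: "negligible N"
    and D: "\<And>t. t \<in> {a..b} - N \<Longrightarrow> (w has_real_derivative g t) (at t within {a..b})"
  shows "(g has_integral (w b - w a)) {a..b}"
proof -
  \<comment> \<open>With the value 0 on \<open>N\<close>, a tag in \<open>N\<close> contributes
    nothing to the Riemann sum, however large \<open>g\<close> may be there; only the increment of
    \<open>w\<close> is left.\<close>
  define g0 where "g0 t = (if t \<in> N then 0 else g t)" for t
  have "(g0 has_integral (w b - w a)) {a..b}"
    unfolding has_integral_real
  proof (intro allI impI)
    fix e :: real assume e: "0 < e"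
    define c where "c = e / (2 * (b - a + 1))"
    have c: "0 < c" "c * (b - a) < e / 2" using e ab by (auto simp: c_def field_simps)
    have "\<exists>r>0. t \<in> {a..b} - N \<longrightarrow> (\<forall>y\<in>{a..b}. \<bar>y - t\<bar> < r \<longrightarrow> \<bar>w y - w t - g t * (y - t)\<bar> \<le> c * \<bar>y - t\<bar>)" for t
    proof (cases "t \<in> {a..b} - N")
      case True
      then show ?thesis
        using D[OF True] c unfolding has_field_derivative_def has_derivative_within_alt by auto
    qed (auto intro: exI[of _ 1])
    then obtain r where r: "\<And>t. 0 < r t"
      "\<And>t y. t \<in> {a..b} - N \<Longrightarrow> y \<in> {a..b} \<Longrightarrow> \<bar>y - t\<bar> < r t \<Longrightarrow> \<bar>w y - w t - g t * (y - t)\<bar> \<le> c * \<bar>y - t\<bar>"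
      by metis
    have "0 < e / 2" using e by simp
    with ac have "\<exists>d>0. \<forall>D S. D division_of S \<and> S \<subseteq> {a..b} \<and> (\<Sum>k\<in>D. Sup k - Inf k) < d
       \<longrightarrow> (\<Sum>k\<in>D. \<bar>w (Sup k) - w (Inf k)\<bar>) < e / 2"
      unfolding abs_continuous_on_def by blast
    then obtain d where d: "0 < d" "\<And>D S. D division_of S \<Longrightarrow> S \<subseteq> {a..b} \<Longrightarrow> (\<Sum>k\<in>D. Sup k - Inf k) < d
       \<Longrightarrow> (\<Sum>k\<in>D. \<bar>w (Sup k) - w (Inf k)\<bar>) < e / 2"
      by blast
    \<comment> \<open>Outer regularity; the bound \<open>d\<close> is the one that absolute
      continuity provides for \<open>e / 2\<close>.\<close>
    obtain U where U: "open U" "N \<subseteq> U" "U \<in> lmeasurable" "measure lebesgue U < d"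
    proof -
      have "N \<in> null_sets lebesgue" using N by (simp add: negligible_iff_null_sets)
      then have Nl: "N \<in> lmeasurable" "measure lebesgue N = 0"
        by (auto simp: fmeasurable_def measure_def)
      obtain T where T: "open T" "N \<subseteq> T" "T - N \<in> lmeasurable" "emeasure lebesgue (T - N) < ennreal d"
        using sets_lebesgue_outer_open[OF fmeasurableD[OF Nl(1)] d(1)] by metis
      have TU: "T = N \<union> (T - N)" using T(2) by auto
      have "T \<in> lmeasurable" using fmeasurable.Un[OF Nl(1) T(3)] TU by simp
      moreover have "measure lebesgue T \<le> measure lebesgue N + measure lebesgue (T - N)"
        using measure_Un_le[of N lebesgue "T - N"] Nl(1) T(3) TU by (simp add: fmeasurableD)
      moreover have "measure lebesgue (T - N) < d"
        using T(3,4) d(1) by (simp add: emeasure_eq_measure2 ennreal_less_iff)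
      ultimately show ?thesis using that T Nl by auto
    qed
    define \<gamma> where "\<gamma> t = (if t \<in> N then U else ball t (r t))" for t
    have \<gamma>: "gauge \<gamma>" using U r by (auto simp: gauge_def \<gamma>_def)
    show "\<exists>\<gamma>. gauge \<gamma> \<and> (\<forall>p. p tagged_division_of {a..b} \<and> \<gamma> fine p \<longrightarrow>
        norm ((\<Sum>(x, k)\<in>p. measure lborel k *\<^sub>R g0 x) - (w b - w a)) < e)"
    proof (intro exI[of _ \<gamma>] conjI allI impI \<gamma>)
      fix p assume "p tagged_division_of {a..b} \<and> \<gamma> fine p"
      then have p: "p tagged_division_of {a..b}" and fine: "\<gamma> fine p" by auto
      have fin: "finite p" using p by blast
      have ppd: "p tagged_partial_division_of {a..b}" using p by (simp add: tagged_division_of_def)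
      define F where "F = (\<lambda>(x, k). measure lborel k * g0 x - (w (Sup k) - w (Inf k)))"
      define pN where "pN = {z \<in> p. fst z \<in> N}"
      have memb: "\<exists>u v. k = {u..v} \<and> u \<le> x \<and> x \<le> v \<and> a \<le> u \<and> v \<le> b \<and> Inf k = u \<and> Sup k = v \<and> measure lborel k = v - u"
        if mem: "(x, k) \<in> p" for x k
      proof -
        obtain u v where "k = cbox u v" using tagged_division_ofD(4)[OF p mem] by auto
        moreover have "x \<in> k" "k \<subseteq> {a..b}" using tagged_division_ofD(2,3)[OF p mem] by auto
        ultimately show ?thesis by (intro exI[of _ u] exI[of _ v]) auto
      qed
      have "(\<Sum>(x, k)\<in>p. measure lborel k *\<^sub>R g0 x) - (w b - w a) = (\<Sum>z\<in>p. F z)"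
        unfolding additive_tagged_division_1[OF ab p, of w, symmetric] F_def
        by (simp add: sum_subtractf[symmetric] case_prod_unfold)
      also have "\<bar>\<dots>\<bar> \<le> (\<Sum>z\<in>p. \<bar>F z\<bar>)" by (rule sum_abs)
      also have "\<dots> = (\<Sum>z\<in>p - pN. \<bar>F z\<bar>) + (\<Sum>z\<in>pN. \<bar>F z\<bar>)"
        using fin by (intro sum.subset_diff) (auto simp: pN_def)
      finally have le: "\<bar>(\<Sum>(x, k)\<in>p. measure lborel k *\<^sub>R g0 x) - (w b - w a)\<bar> \<le>
        (\<Sum>z\<in>p - pN. \<bar>F z\<bar>) + (\<Sum>z\<in>pN. \<bar>F z\<bar>)" .
      have "(\<Sum>z\<in>p - pN. \<bar>F z\<bar>) \<le> (\<Sum>z\<in>p - pN. c * measure lborel (snd z))"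
      proof (rule sum_mono)
        fix z assume z: "z \<in> p - pN"
        obtain x k where xk: "z = (x, k)" by force
        with z have xN: "x \<notin> N" and zp: "(x, k) \<in> p" by (auto simp: pN_def)
        from memb[OF zp] obtain u v where uv: "k = {u..v}" "u \<le> x" "x \<le> v" "a \<le> u" "v \<le> b"
          "Inf k = u" "Sup k = v" "measure lborel k = v - u" by blast
        have "k \<subseteq> ball x (r x)" using fineD[OF fine zp] xN by (simp add: \<gamma>_def)
        then have "\<bar>u - x\<bar> < r x" "\<bar>v - x\<bar> < r x" using uv subsetD[of k "ball x (r x)" u] subsetD[of k "ball x (r x)" v] by (auto simp: dist_real_def abs_minus_commute)
        then have "\<bar>w u - w x - g x * (u - x)\<bar> \<le> c * (x - u)" "\<bar>w v - w x - g x * (v - x)\<bar> \<le> c * (v - x)"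
          using r(2)[of x u] r(2)[of x v] uv xN by auto
        then have "\<bar>(v - u) * g x - (w v - w u)\<bar> \<le> c * (v - u)"
          by (simp add: abs_le_iff algebra_simps)
        then show "\<bar>F z\<bar> \<le> c * measure lborel (snd z)"
          using uv xN by (simp add: F_def xk g0_def)
      qed
      also have "\<dots> \<le> (\<Sum>z\<in>p. c * measure lborel (snd z))"
        using fin c by (intro sum_mono2) auto
      also have "\<dots> = c * (b - a)"
        using additive_content_tagged_division[of p a b] p ab
        by (simp add: sum_distrib_left[symmetric] case_prod_unfold)
      finally have 1: "(\<Sum>z\<in>p - pN. \<bar>F z\<bar>) < e / 2" using c by linarith
      have pN: "pN tagged_partial_division_of {a..b}"
        by (rule tagged_partial_division_subset[OF ppd]) (auto simp: pN_def)
      \<comment> \<open>Passing from tagged pairs to intervals requires a summand that vanishes on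
        every box with empty interior. The empty set is one of these, and its \<open>Inf\<close> and
        \<open>Sup\<close> carry no information, so it gets the value 0 by hand.\<close>
      define G where "G k = (if k = {} then 0 else \<bar>w (Sup k) - w (Inf k)\<bar>)" for k
      have "(\<Sum>z\<in>pN. \<bar>F z\<bar>) = (\<Sum>(x, k)\<in>pN. G k)"
      proof (rule sum.cong[OF refl])
        fix z assume "z \<in> pN"
        then obtain x k where z: "z = (x, k)" "(x, k) \<in> p" "x \<in> N" by (cases z) (auto simp: pN_def)
        then have "k \<noteq> {}" using tagged_division_ofD(2)[OF p z(2)] by auto
        then show "\<bar>F z\<bar> = (case z of (x, k) \<Rightarrow> G k)"
          using z by (simp add: F_def G_def g0_def abs_minus_commute)
      qed
      also have "\<dots> = (\<Sum>k\<in>snd ` pN. G k)"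
      proof (rule sum.over_tagged_division_lemma[OF tagged_partial_division_of_Union_self[OF pN]])
        show "G (cbox u v) = 0" if "box u v = {}" for u v :: real
        proof (cases "cbox u v = {}")
          case False
          then have "u = v" using that by auto
          then show ?thesis by (simp add: G_def)
        qed (simp add: G_def)
      qed
      also have "\<dots> \<le> (\<Sum>k\<in>snd ` pN. \<bar>w (Sup k) - w (Inf k)\<bar>)"
        by (intro sum_mono) (auto simp: G_def)
      also have "\<dots> < e / 2"
      proof (rule d(2))
        show div: "snd ` pN division_of \<Union>(snd ` pN)"
          by (rule partial_division_of_tagged_division[OF pN])
        show "\<Union>(snd ` pN) \<subseteq> {a..b}"
          using tagged_partial_division_ofD(3)[OF pN] by force
        have "\<Union>(snd ` pN) \<subseteq> U"
          using fineD[OF fine] by (force simp: \<gamma>_def pN_def)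
        then have "measure lebesgue (\<Union>(snd ` pN)) \<le> measure lebesgue U"
          using U lmeasurable_division[OF div] by (intro measure_mono_fmeasurable) auto
        then show "(\<Sum>k\<in>snd ` pN. Sup k - Inf k) < d"
          using U division_sum_lengths[OF div] by simp
      qed
      finally show "norm ((\<Sum>(x, k)\<in>p. measure lborel k *\<^sub>R g0 x) - (w b - w a)) < e"
        using le 1 by simp
    qed
  qed
  then show ?thesis
    by (rule has_integral_spike[OF N, rotated]) (auto simp: g0_def)
qed

section \<open>Order 1: the indefinite integral and Lebesgue differentiation\<close>

lemma frac_conv_1_diff:
  assumes [measurable]: "h \<in> borel_measurable borel" and M: "\<And>s. \<bar>h s\<bar> \<le> M"
    and h0: "\<And>s. s < a \<Longrightarrow> h s = 0" and xy: "x \<le> y"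
  shows "(h has_integral (frac_conv 1 h y - frac_conv 1 h x)) {x..y}"
proof -
  have int: "integrable lborel (\<lambda>s. frac_kernel 1 (t - s) * h s)" for t
    by (rule frac_conv_integrable[where M=M and a=a]) (use M h0 in auto)
  \<comment> \<open>Two translates of the order 1 kernel differ by the indicator of the half-open
    interval from \<open>x\<close> to \<open>y\<close>; only the point \<open>y\<close> is
    lost.\<close>
  have eq: "AE s in lborel. indicator {x..y} s *\<^sub>R h s = frac_kernel 1 (y - s) * h s - frac_kernel 1 (x - s) * h s"
    using AE_lborel_singleton[of y]
    by eventually_elim (use xy in \<open>auto simp: frac_kernel_1 indicator_def\<close>)
  have si: "integrable lborel (\<lambda>s. indicator {x..y} s *\<^sub>R h s)"
    by (subst integrable_cong_AE[OF _ _ eq]) (auto intro!: Bochner_Integration.integrable_diff int)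
  have "(LINT s|lborel. indicator {x..y} s *\<^sub>R h s) = frac_conv 1 h y - frac_conv 1 h x"
    unfolding frac_conv_def
    by (subst integral_cong_AE[OF _ _ eq]) (auto intro!: Bochner_Integration.integral_diff int)
  then show ?thesis
    using has_integral_integral_lborel[OF si] has_integral_restrict_UNIV[of "{x..y}" h]
    by (simp only: indicator_scaleR_eq_if)
qed

lemma frac_conv_1_Lipschitz:
  assumes [measurable]: "h \<in> borel_measurable borel" and M: "\<And>s. \<bar>h s\<bar> \<le> M"
    and h0: "\<And>s. s < a \<Longrightarrow> h s = 0" and xy: "x \<le> y"
  shows "\<bar>frac_conv 1 h y - frac_conv 1 h x\<bar> \<le> M * (y - x)"
proof -
  have "0 \<le> M" using M[of 0] by linarith
  moreover have "(h has_integral (frac_conv 1 h y - frac_conv 1 h x)) (cbox x y)"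
    using frac_conv_1_diff[OF assms] by simp
  ultimately show ?thesis
    using has_integral_bound[of M h _ x y] M xy by auto
qed

lemma frac_conv_1_has_derivative:
  assumes h [measurable]: "h \<in> borel_measurable borel" and M: "\<And>s. \<bar>h s\<bar> \<le> M"
    and h0: "\<And>s. s < a \<Longrightarrow> h s = 0"
  obtains N where "negligible N" "\<And>t. t \<notin> N \<Longrightarrow> (frac_conv 1 h has_real_derivative h t) (at t)"
proof -
  have diff: "(h has_integral (frac_conv 1 h y - frac_conv 1 h x)) {x..y}" if "x \<le> y" for x y
    using assms that by (rule frac_conv_1_diff)
  have I1: "h integrable_on cbox x y" for x y
    using diff[of x y] by (cases "x \<le> y") auto
  \<comment> \<open>Differentiation of the integral is applied to averages over
    \<open>{x..x + k}\<close>, which control right difference quotients. The left quotients at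
    \<open>t\<close> are right quotients at \<open>- t\<close> of the reflected function, hence the
    mirror image of \<open>N2\<close> in the exceptional set.\<close>
  have I2: "(\<lambda>s. h (- s)) integrable_on cbox x y" for x y
    using I1[of "-y" "-x"] integrable_reflect[of h "-x" "-y"] by simp
  obtain N1 where N1: "negligible N1" "\<And>x e. x \<notin> N1 \<Longrightarrow> 0 < e \<Longrightarrow>
      \<exists>d>0. \<forall>k. 0 < k \<and> k < d \<longrightarrow> \<bar>integral {x..x + k} h / k - h x\<bar> < e"
    using integrable_ccontinuous_explicit[of h] I1 by (auto simp: divide_inverse mult.commute)
  obtain N2 where N2: "negligible N2" "\<And>x e. x \<notin> N2 \<Longrightarrow> 0 < e \<Longrightarrow>
      \<exists>d>0. \<forall>k. 0 < k \<and> k < d \<longrightarrow> \<bar>integral {x..x + k} (\<lambda>s. h (- s)) / k - h (- x)\<bar> < e"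
    using integrable_ccontinuous_explicit[of "\<lambda>s. h (- s)"] I2 by (auto simp: divide_inverse mult.commute)
  define N where "N = N1 \<union> uminus ` N2"
  have "negligible N"
    unfolding N_def using N1(1) N2(1)
    by (intro negligible_Un negligible_differentiable_image_negligible differentiable_on_minus differentiable_on_ident) auto
  moreover have "(frac_conv 1 h has_real_derivative h t) (at t)" if t: "t \<notin> N" for t
    unfolding DERIV_def LIM_eq
  proof (intro allI impI)
    fix e :: real assume e: "0 < e"
    have t1: "t \<notin> N1" and t2: "- t \<notin> N2" using t by (force simp: N_def)+
    obtain d1 where d1: "0 < d1" "\<And>k. 0 < k \<Longrightarrow> k < d1 \<Longrightarrow> \<bar>integral {t..t + k} h / k - h t\<bar> < e"
      using N1(2)[OF t1 e] by auto
    obtain d2 where d2: "0 < d2" "\<And>k. 0 < k \<Longrightarrow> k < d2 \<Longrightarrow> \<bar>integral {- t..- t + k} (\<lambda>s. h (- s)) / k - h t\<bar> < e"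
      using N2(2)[OF t2 e] by auto
    show "\<exists>s>0. \<forall>x. x \<noteq> 0 \<and> norm (x - 0) < s \<longrightarrow> norm ((frac_conv 1 h (t + x) - frac_conv 1 h t) / x - h t) < e"
    proof (intro exI[of _ "min d1 d2"] conjI allI impI)
      fix x :: real assume x: "x \<noteq> 0 \<and> norm (x - 0) < min d1 d2"
      show "norm ((frac_conv 1 h (t + x) - frac_conv 1 h t) / x - h t) < e"
      proof (cases "0 < x")
        case True
        then show ?thesis using d1(2)[of x] x integral_unique[OF diff[of t "t + x"]] by simp
      next
        case False
        then have "integral {- t..- t + - x} (\<lambda>s. h (- s)) = frac_conv 1 h t - frac_conv 1 h (t + x)"
          using x Henstock_Kurzweil_Integration.integral_reflect_real[of t "t + x" h] integral_unique[OF diff[of "t + x" t]] by simp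
        then show ?thesis using d2(2)[of "- x"] x False
          by (simp add: minus_divide_left[symmetric] minus_diff_eq[symmetric, of "frac_conv 1 h t"] del: minus_diff_eq)
      qed
    qed (use d1 d2 in auto)
  qed
  ultimately show ?thesis by (rule that)
qed

section \<open>Intervals starting at \<open>a\<close>, null sets and continuous functions\<close>

lemma intervals_from_Icc:
  assumes "I \<in> intervals_from a" "b \<in> I"
  shows "{a..b} \<subseteq> I"
proof
  fix s assume "s \<in> {a..b}"
  moreover have "is_interval I" "a \<in> I" using assms(1) by (auto simp: intervals_from_def)
  ultimately show "s \<in> I" using mem_is_interval_1_I[of I a b s] assms(2) by auto
qed

lemma AE_lebesgue_on_iff:
  assumes "S \<in> sets lebesgue"
  shows "(AE t in lebesgue_on S. P t) \<longleftrightarrow> (\<exists>N. negligible N \<and> (\<forall>t\<in>S - N. P t))"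
proof -
  have "(AE t in lebesgue_on S. P t) \<longleftrightarrow> (AE t in lebesgue. t \<in> S \<longrightarrow> P t)"
    using assms by (intro AE_restrict_space_iff) simp
  also have "\<dots> \<longleftrightarrow> (\<exists>N. negligible N \<and> (\<forall>t\<in>S - N. P t))"
    unfolding eventually_ae_filter negligible_iff_null_sets
  proof safe
    fix N assume "N \<in> null_sets lebesgue" "{x \<in> space lebesgue. \<not> (x \<in> S \<longrightarrow> P x)} \<subseteq> N"
    then show "\<exists>N. N \<in> null_sets lebesgue \<and> (\<forall>t\<in>S - N. P t)" by auto
  next
    fix N assume "N \<in> null_sets lebesgue" "\<forall>t\<in>S - N. P t"
    then show "\<exists>N\<in>null_sets lebesgue. {x \<in> space lebesgue. \<not> (x \<in> S \<longrightarrow> P x)} \<subseteq> N" by auto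
  qed
  finally show ?thesis .
qed

lemma interval_lebesgue: "is_interval S \<Longrightarrow> (S :: real set) \<in> sets lebesgue"
  by (simp add: real_interval_borel_measurable)

text \<open>If the functions differed at \<open>t\<close>, they would differ at all nearby points of
  \<open>I\<close>; as \<open>I\<close> is nondegenerate, these include a nonempty open set, which
  is not negligible.\<close>

lemma continuous_eq_except_negligible:
  fixes v w :: "real \<Rightarrow> real"
  assumes I: "is_interval I" and a: "{a} \<subset> I"
    and v: "continuous_on I v" and w: "continuous_on I w" and N: "negligible N"
    and eq: "\<And>t. t \<in> I - N \<Longrightarrow> v t = w t" and t: "t \<in> I"
  shows "v t = w t"
proof (rule ccontr)
  assume ne: "v t \<noteq> w t"
  have "continuous_on I (\<lambda>s. v s - w s)" using v w by (intro continuous_intros)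
  moreover have "0 < \<bar>v t - w t\<bar>" using ne by simp
  ultimately have "\<exists>d>0. \<forall>s\<in>I. dist s t < d \<longrightarrow> dist (v s - w s) (v t - w t) < \<bar>v t - w t\<bar>"
    using t unfolding continuous_on_iff by blast
  then obtain d where d: "0 < d" "\<And>s. s \<in> I \<Longrightarrow> dist s t < d \<Longrightarrow> dist (v s - w s) (v t - w t) < \<bar>v t - w t\<bar>"
    by blast
  obtain p where p: "p \<in> I" "p \<noteq> t"
  proof (cases "t = a")
    case True
    then show ?thesis using that psubset_imp_ex_mem[OF a] by auto
  qed (use a that[of a] in auto)
  \<comment> \<open>As \<open>t\<close> may be an end point of \<open>I\<close>, the open set lies
    on one side of it, towards another point \<open>p\<close> of \<open>I\<close>.\<close>
  define U where "U = {min t p<..<max t p} \<inter> ball t d"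
  have "min t p \<in> I" "max t p \<in> I" using p t by (auto simp: min_def max_def)
  have UI: "U \<subseteq> I"
  proof
    fix s assume "s \<in> U"
    then have "min t p \<le> s" "s \<le> max t p" by (simp_all add: U_def)
    with mem_is_interval_1_I[OF I \<open>min t p \<in> I\<close> \<open>max t p \<in> I\<close>] show "s \<in> I" by blast
  qed
  have "U \<subseteq> N"
  proof
    fix s assume s: "s \<in> U"
    then have "s \<in> I" "dist s t < d" using UI by (auto simp: U_def dist_commute)
    then have "v s \<noteq> w s" using d(2)[of s] by (auto simp: dist_real_def)
    then show "s \<in> N" using eq[of s] \<open>s \<in> I\<close> by auto
  qed
  then have "negligible U" using N negligible_subset by blast
  moreover have "open U" by (simp add: U_def open_Int)
  moreover have "U \<noteq> {}"
  proof -
    define m where "m = min \<bar>p - t\<bar> d / 2"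
    have m: "0 < m" "m < \<bar>p - t\<bar>" "m < d" using p(2) d(1) by (auto simp: m_def min_def)
    show ?thesis
    proof (cases "t < p")
      case True
      then have "t + m \<in> U" using m by (simp add: U_def dist_real_def)
      then show ?thesis by auto
    next
      case False
      then have "t - m \<in> U" using m by (simp add: U_def dist_real_def)
      then show ?thesis by auto
    qed
  qed
  ultimately show False using open_not_negligible by blast
qed

section \<open>Fractional integrals of bounded measurable functions\<close>

text \<open>For such functions the fractional integrals of positive order exist at every point of a
  compact interval, not merely almost everywhere.\<close>

definition bounded_measurable :: "real set \<Rightarrow> (real \<Rightarrow> real) \<Rightarrow> bool" where
  "bounded_measurable S g \<longleftrightarrow> g \<in> borel_measurable (lebesgue_on S) \<and> (\<exists>M. \<forall>s\<in>S. \<bar>g s\<bar> \<le> M)"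

lemma bounded_measurable_continuous:
  assumes "continuous_on {a..b} u"
  shows "bounded_measurable {a..b} u"
  unfolding bounded_measurable_def
proof
  show "u \<in> borel_measurable (lebesgue_on {a..b})"
    using assms by (intro continuous_imp_measurable_on_sets_lebesgue) auto
  have "bounded (u ` {a..b})"
    using assms by (intro compact_imp_bounded compact_continuous_image) auto
  then show "\<exists>M. \<forall>s\<in>{a..b}. \<bar>u s\<bar> \<le> M" by (auto simp: bounded_iff)
qed

text \<open>The bridge from Lebesgue measurable functions on \<open>{a..b}\<close> to the
  convolution calculus. One Borel function \<open>h\<close> serves all orders and all times, so
  integrals of different orders can be compared.\<close>

lemma frac_integral_pt_conv:
  assumes g: "bounded_measurable {a..b} g"
  obtains h M N where "h \<in> borel_measurable borel" "\<And>s. \<bar>h s\<bar> \<le> M" "\<And>s. s < a \<Longrightarrow> h s = 0"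
    "negligible N" "\<And>s. s \<in> {a..b} - N \<Longrightarrow> h s = g s"
    "\<And>\<alpha> t. 0 < \<alpha> \<Longrightarrow> t \<in> {a..b} \<Longrightarrow> frac_integral_pt a \<alpha> g t = frac_conv \<alpha> h t"
proof -
  obtain M where M: "\<And>s. s \<in> {a..b} \<Longrightarrow> \<bar>g s\<bar> \<le> M" and
    gm: "g \<in> borel_measurable (lebesgue_on {a..b})" using g unfolding bounded_measurable_def by blast
  define g0 where "g0 s = (if s \<in> {a..b} then g s else 0)" for s
  have g0 [measurable]: "g0 \<in> borel_measurable lebesgue"
    unfolding g0_def using gm by (intro borel_measurable_if_I) auto
  obtain g' where g' [measurable]: "g' \<in> borel_measurable lborel" and ae: "AE s in lborel. g0 s = g' s"
    using completion_ex_borel_measurable_real[OF g0] by auto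
  \<comment> \<open>The Borel version \<open>g'\<close> may be unbounded on the null set where it
    differs from \<open>g0\<close>. Clamping restores a global bound and changes nothing where the
    two agree.\<close>
  define h where "h s = (if s \<in> {a..b} then max (- \<bar>M\<bar>) (min \<bar>M\<bar> (g' s)) else 0)" for s
  have h [measurable]: "h \<in> borel_measurable borel"
    using g' unfolding h_def by measurable
  from AE_completion[OF ae] obtain N where N0: "N \<in> null_sets lebesgue" "{s. g0 s \<noteq> g' s} \<subseteq> N"
    by (auto simp: eventually_ae_filter)
  have N: "negligible N" using N0 by (simp add: negligible_iff_null_sets)
  have hg: "h s = g s" if s: "s \<in> {a..b} - N" for s
  proof -
    have "g0 s = g' s" using s N0(2) by blast
    then have "g' s = g s" using s by (simp add: g0_def)
    then show ?thesis using s M[of s] by (auto simp: h_def)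
  qed
  have "frac_integral_pt a \<alpha> g t = frac_conv \<alpha> h t" if al: "0 < \<alpha>" and t: "t \<in> {a..b}" for \<alpha> t
  proof -
    have [measurable]: "(\<lambda>s. indicator {a..t} s * (1 / Gamma \<alpha> * (t - s) powr (\<alpha> - 1))) \<in> borel_measurable lebesgue"
      "(\<lambda>s. frac_kernel \<alpha> (t - s) * h s) \<in> borel_measurable lebesgue"
      by (rule measurable_completion, measurable)+
    have "frac_integral_pt a \<alpha> g t = (LINT s|lebesgue. (indicator {a..t} s * (1 / Gamma \<alpha> * (t - s) powr (\<alpha> - 1))) * g0 s)"
      using al t unfolding frac_integral_pt_def set_lebesgue_integral_def
      by (auto intro!: Bochner_Integration.integral_cong simp: g0_def indicator_def)
    also have "\<dots> = (LINT s|lebesgue. frac_kernel \<alpha> (t - s) * h s)"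
    proof (rule integral_cong_AE)
      have "AE s in lebesgue. s \<notin> N"
        using N0(1) by (rule AE_not_in)
      then show "AE s in lebesgue. (indicator {a..t} s * (1 / Gamma \<alpha> * (t - s) powr (\<alpha> - 1))) * g0 s = frac_kernel \<alpha> (t - s) * h s"
      proof eventually_elim
        case (elim s)
        show ?case
        proof (cases "s \<in> {a..b}")
          case True
          then show ?thesis using hg[of s] elim t
            by (auto simp: g0_def indicator_def frac_kernel_def)
        next
          case False
          then have "g0 s = 0" "h s = 0" by (auto simp: g0_def h_def)
          then show ?thesis by simp
        qed
      qed
    qed measurable
    also have "\<dots> = frac_conv \<alpha> h t"
      unfolding frac_conv_def by (rule integral_completion) measurable
    finally show ?thesis .
  qed
  moreover have "\<bar>h s\<bar> \<le> \<bar>M\<bar>" "s < a \<Longrightarrow> h s = 0" for s by (auto simp: h_def)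
  ultimately show ?thesis using h N hg that by metis
qed

lemma frac_integral_pt_continuous:
  assumes "bounded_measurable {a..b} g" "0 < \<alpha>" "\<alpha> \<le> 1"
  shows "continuous_on {a..b} (frac_integral_pt a \<alpha> g)"
proof -
  obtain h M N where h: "h \<in> borel_measurable borel" "\<And>s. \<bar>h s\<bar> \<le> M" "\<And>s. s < a \<Longrightarrow> h s = 0"
    "\<And>\<alpha> t. 0 < \<alpha> \<Longrightarrow> t \<in> {a..b} \<Longrightarrow> frac_integral_pt a \<alpha> g t = frac_conv \<alpha> h t"
    using frac_integral_pt_conv[OF assms(1)] by metis
  have "continuous_on UNIV (frac_conv \<alpha> h)"
    by (rule frac_conv_continuous[OF h(1-3) assms(2,3)])
  then have "continuous_on {a..b} (frac_conv \<alpha> h)" by (rule continuous_on_subset) simp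
  then show ?thesis using h(4) assms(2) by (metis (no_types, lifting) continuous_on_cong)
qed

lemma frac_integral_pt_start:
  assumes "0 < \<alpha>"
  shows "frac_integral_pt a \<alpha> g a = 0"
proof -
  have zero: "indicator {a..a} s *\<^sub>R (1 / Gamma \<alpha> * (a - s) powr (\<alpha> - 1) * g s) = 0" for s
    by (auto simp: indicator_def)
  show ?thesis using assms unfolding frac_integral_pt_def set_lebesgue_integral_def zero by simp
qed

lemma frac_conv_cong_AE:
  assumes [measurable]: "h \<in> borel_measurable borel" "h' \<in> borel_measurable borel"
    and N: "negligible N" and eq: "\<And>s. s < t \<Longrightarrow> s \<notin> N \<Longrightarrow> h s = h' s"
  shows "frac_conv \<alpha> h t = frac_conv \<alpha> h' t"
  unfolding frac_conv_def
proof (rule integral_cong_AE)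
  have "AE s in lebesgue. s \<notin> N"
    using N by (intro AE_not_in) (simp add: negligible_iff_null_sets)
  then have "AE s in lborel. s \<notin> N" by (simp add: AE_completion_iff)
  then show "AE s in lborel. frac_kernel \<alpha> (t - s) * h s = frac_kernel \<alpha> (t - s) * h' s"
  proof eventually_elim
    case (elim s)
    then show ?case using eq[of s] by (cases "s < t") auto
  qed
qed measurable

text \<open>From right to left this is the semigroup law. From left to right, integrating both sides
  with order \<alpha> shows that \<open>u\<close> and the order \<alpha> integral of
  \<open>g\<close> have the same indefinite integral; differentiation makes them equal almost
  everywhere, continuity everywhere. For \<open>\<alpha> = 1\<close> the integral of order 0 is the
  identity by definition, not a convolution, hence the separate case.\<close>

lemma frac_integral_pt_complement_iff:
  assumes ab: "a < b" and al: "0 < \<alpha>" "\<alpha> \<le> 1" and u: "continuous_on {a..b} u"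
    and g: "bounded_measurable {a..b} g"
  shows "(\<forall>t\<in>{a..b}. frac_integral_pt a (1 - \<alpha>) u t = frac_integral_pt a 1 g t) \<longleftrightarrow>
    (\<forall>t\<in>{a..b}. u t = frac_integral_pt a \<alpha> g t)"
proof (cases "\<alpha> = 1")
  case True
  then show ?thesis by (simp add: frac_integral_pt_def)
next
  case False
  then have be: "0 < 1 - \<alpha>" "1 - \<alpha> \<le> 1" using al by auto
  obtain h M N where h: "h \<in> borel_measurable borel" "\<And>s. \<bar>h s\<bar> \<le> M" "\<And>s. s < a \<Longrightarrow> h s = 0"
    "negligible N" "\<And>s. s \<in> {a..b} - N \<Longrightarrow> h s = g s"
    "\<And>\<alpha> t. 0 < \<alpha> \<Longrightarrow> t \<in> {a..b} \<Longrightarrow> frac_integral_pt a \<alpha> g t = frac_conv \<alpha> h t"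
    using frac_integral_pt_conv[OF g] by metis
  obtain w M' N' where w: "w \<in> borel_measurable borel" "\<And>s. \<bar>w s\<bar> \<le> M'" "\<And>s. s < a \<Longrightarrow> w s = 0"
    "negligible N'" "\<And>s. s \<in> {a..b} - N' \<Longrightarrow> w s = u s"
    "\<And>\<alpha> t. 0 < \<alpha> \<Longrightarrow> t \<in> {a..b} \<Longrightarrow> frac_integral_pt a \<alpha> u t = frac_conv \<alpha> w t"
    using frac_integral_pt_conv[OF bounded_measurable_continuous[OF u]] by metis
  note [measurable] = h(1) w(1)
  have hh: "frac_conv \<beta> (frac_conv \<gamma> h) t = frac_conv (\<beta> + \<gamma>) h t" if "0 < \<beta>" "0 < \<gamma>" for \<beta> \<gamma> t
    by (rule frac_conv_frac_conv[OF h(1-3) that])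
  have ww: "frac_conv \<beta> (frac_conv \<gamma> w) t = frac_conv (\<beta> + \<gamma>) w t" if "0 < \<beta>" "0 < \<gamma>" for \<beta> \<gamma> t
    by (rule frac_conv_frac_conv[OF w(1-3) that])
  show ?thesis
  proof
    assume R: "\<forall>t\<in>{a..b}. u t = frac_integral_pt a \<alpha> g t"
    show "\<forall>t\<in>{a..b}. frac_integral_pt a (1 - \<alpha>) u t = frac_integral_pt a 1 g t"
    proof
      fix t assume t: "t \<in> {a..b}"
      have "w s = frac_conv \<alpha> h s" if "s < t" "s \<notin> N'" for s
      proof (cases "s < a")
        case True
        then show ?thesis using w(3) frac_conv_before[OF h(3), of s] by simp
      next
        case False
        then show ?thesis using w(5)[of s] h(6)[of \<alpha> s] R that t al by auto
      qed
      then have "frac_conv (1 - \<alpha>) w t = frac_conv (1 - \<alpha>) (frac_conv \<alpha> h) t"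
        using w(4) by (intro frac_conv_cong_AE) auto
      then show "frac_integral_pt a (1 - \<alpha>) u t = frac_integral_pt a 1 g t"
        using w(6)[OF be(1) t] h(6)[of 1 t] hh[OF be(1) al(1)] t by simp
    qed
  next
    assume L: "\<forall>t\<in>{a..b}. frac_integral_pt a (1 - \<alpha>) u t = frac_integral_pt a 1 g t"
    have LL: "frac_conv (1 - \<alpha>) w t = frac_conv 1 h t" if "t \<le> b" for t
    proof (cases "t < a")
      case True
      then show ?thesis using frac_conv_before[OF w(3), of t] frac_conv_before[OF h(3), of t] by simp
    next
      case False
      then show ?thesis using w(6)[OF be(1), of t] h(6)[of 1 t] L that by auto
    qed
    have cont: "continuous_on UNIV (frac_conv \<alpha> h)"
      by (rule frac_conv_continuous[OF h(1-3) al])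
    then have cont': "continuous_on {a..b} (frac_conv \<alpha> h)" by (rule continuous_on_subset) simp
    \<comment> \<open>Differentiating the order 1 convolution asks for a globally bounded function.
      Cutting off outside \<open>{a..b}\<close> is invisible for \<open>t < b\<close>, because
      \<open>frac_conv \<alpha> h\<close> already vanishes before \<open>a\<close>.\<close>
    define v where "v s = (if s \<in> {a..b} then frac_conv \<alpha> h s else 0)" for s
    have v [measurable]: "v \<in> borel_measurable borel" unfolding v_def by measurable
    obtain B0 where "\<And>s. s \<in> {a..b} \<Longrightarrow> \<bar>frac_conv \<alpha> h s\<bar> \<le> B0"
      using bounded_measurable_continuous[OF cont'] unfolding bounded_measurable_def by blast
    then have vB: "\<bar>v s\<bar> \<le> \<bar>B0\<bar>" for s by (force simp: v_def)
    have v0: "v s = 0" if "s < a" for s using that by (simp add: v_def)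
    have eq1: "frac_conv 1 w t = frac_conv 1 v t" if "t < b" for t
    proof -
      have "frac_conv 1 w t = frac_conv \<alpha> (frac_conv (1 - \<alpha>) w) t"
        using ww[OF al(1) be(1)] by simp
      also have "\<dots> = frac_conv \<alpha> (frac_conv 1 h) t"
        using LL that by (intro frac_conv_cong) auto
      also have "\<dots> = frac_conv 1 (frac_conv \<alpha> h) t"
        using hh[of \<alpha> 1] hh[of 1 \<alpha>] al by (simp add: add.commute)
      also have "\<dots> = frac_conv 1 v t"
        using that frac_conv_before[OF h(3)] by (intro frac_conv_cong) (auto simp: v_def)
      finally show ?thesis .
    qed
    obtain N1 where N1: "negligible N1" "\<And>t. t \<notin> N1 \<Longrightarrow> (frac_conv 1 w has_real_derivative w t) (at t)"
      using frac_conv_1_has_derivative[OF w(1-3)] by metis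
    obtain N2 where N2: "negligible N2" "\<And>t. t \<notin> N2 \<Longrightarrow> (frac_conv 1 v has_real_derivative v t) (at t)"
      using frac_conv_1_has_derivative[OF v vB v0] by metis
    \<comment> \<open>The point \<open>b\<close> is excluded because derivatives are compared on the
      open set \<open>{..<b}\<close>.\<close>
    have neg: "negligible (N' \<union> N1 \<union> N2 \<union> {b})"
      using w(4) N1(1) N2(1) by auto
    have uv: "u t = frac_conv \<alpha> h t" if t: "t \<in> {a..b} - (N' \<union> N1 \<union> N2 \<union> {b})" for t
    proof -
      have "(frac_conv 1 v has_real_derivative w t) (at t)"
        by (rule has_field_derivative_transform_within_open[OF N1(2), of _ "{..<b}"]) (use t eq1 in auto)
      then have "w t = v t" using N2(2)[of t] t by (auto intro: DERIV_unique)
      then show ?thesis using w(5)[of t] t by (auto simp: v_def)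
    qed
    have "u t = frac_conv \<alpha> h t" if t: "t \<in> {a..b}" for t
      by (rule continuous_eq_except_negligible[OF _ _ u cont' neg uv t, of a])
         (use ab in \<open>auto simp: is_interval_cc\<close>)
    then show "\<forall>t\<in>{a..b}. u t = frac_integral_pt a \<alpha> g t"
      using h(6)[OF al(1)] by simp
  qed
qed

text \<open>Results on the compact intervals \<open>{a..c}\<close> each bring their own null set. A
  countable cofinal set of end points keeps the union negligible even if \<open>I\<close> is not
  compact: the rationals of \<open>I\<close>, together with the maximum of \<open>I\<close> if there
  is one.\<close>

lemma intervals_from_countable_cofinal:
  assumes I: "I \<in> intervals_from a"
  obtains C where "countable C" "C \<subseteq> I" "\<And>t. t \<in> I \<Longrightarrow> \<exists>c\<in>C. t \<le> c"
proof
  let ?E = "{t \<in> I. \<forall>s\<in>I. s \<le> t}"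
  have "?E \<subseteq> {Sup I}" by (auto intro!: cSup_eq_maximum[symmetric])
  then have "countable ?E" by (rule countable_subset) simp
  then show "countable ((\<rat> \<inter> I) \<union> ?E)" by (simp add: countable_rat countable_Int1)
  show "(\<rat> \<inter> I) \<union> ?E \<subseteq> I" by auto
  fix t assume t: "t \<in> I"
  show "\<exists>c\<in>(\<rat> \<inter> I) \<union> ?E. t \<le> c"
  proof (cases "\<forall>s\<in>I. s \<le> t")
    case False
    then obtain s where s: "s \<in> I" "t < s" by auto
    then obtain r where r: "r \<in> \<rat>" "t < r" "r < s" using Rats_dense_in_real by blast
    then have "r \<in> I" using mem_is_interval_1_I[of I t s r] I t s by (auto simp: intervals_from_def)
    then show ?thesis using r by (intro bexI[of _ r]) auto
  qed (use t in auto)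
qed

lemma continuous_on_intervals_from:
  fixes f :: "real \<Rightarrow> 'b :: topological_space"
  assumes I: "I \<in> intervals_from a" and f: "\<And>b. b \<in> I \<Longrightarrow> continuous_on {a..b} f"
  shows "continuous_on I f"
  unfolding continuous_on_eq_continuous_within
proof
  fix t assume t: "t \<in> I"
  have Ia: "I \<subseteq> {a..}" using I by (auto simp: intervals_from_def)
  obtain b where b: "b \<in> I" "t \<le> b" "at t within I = at t within {a..b}"
  proof (cases "\<forall>s\<in>I. s \<le> t")
    case True
    then have "I = {a..t}" using intervals_from_Icc[OF I t] Ia by auto
    then show ?thesis using that t by auto
  next
    case False
    then obtain b where b: "b \<in> I" "t < b" by auto
    have "at t within I = at t within {a..b}"
      by (rule at_within_nhd[of _ "{..<b}"]) (use b Ia intervals_from_Icc[OF I b(1)] in auto)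
    then show ?thesis using that b by auto
  qed
  have "continuous (at t within {a..b}) f"
    using f[OF b(1)] b t Ia by (auto simp: continuous_on_eq_continuous_within)
  then show "continuous (at t within I) f" using b(3) by (simp add: continuous_within)
qed

text \<open>\<open>SOME\<close> may pick any continuous function almost everywhere equal to
  \<open>u\<close>, but on a nondegenerate interval all of them agree at every point.\<close>

lemma continuous_version_eq:
  assumes I: "I \<in> intervals_from a" and u: "continuous_on I u" and t: "t \<in> I"
  shows "continuous_version I u t = u t"
proof -
  have II: "is_interval I" "{a} \<subset> I" using I by (auto simp: intervals_from_def)
  let ?P = "\<lambda>v. continuous_on I v \<and> (AE t in lebesgue_on I. v t = u t)"
  have "?P u" using u by simp
  then have ex: "\<exists>v. ?P v" by blast
  then have "?P (continuous_version I u)"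
    unfolding continuous_version_def if_P[OF ex] by (rule someI_ex)
  then obtain N where "negligible N" "\<forall>t\<in>I - N. continuous_version I u t = u t" "continuous_on I (continuous_version I u)"
    using AE_lebesgue_on_iff[OF interval_lebesgue[OF II(1)]] by auto
  then show ?thesis using continuous_eq_except_negligible[OF II _ u _ _ t] by blast
qed

lemma frac_integral_eq_pt:
  assumes I: "I \<in> intervals_from a" and u: "continuous_on I u" and be: "0 \<le> \<beta>" "\<beta> \<le> 1" and t: "t \<in> I"
  shows "frac_integral a \<beta> I u t = frac_integral_pt a \<beta> u t"
proof -
  have "continuous_on I (frac_integral_pt a \<beta> u)"
  proof (cases "\<beta> = 0")
    case True
    then have "frac_integral_pt a \<beta> u = u" by (auto simp: frac_integral_pt_def)
    then show ?thesis using u by simp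
  next
    case False
    show ?thesis
    proof (rule continuous_on_intervals_from[OF I])
      fix b assume b: "b \<in> I"
      have "continuous_on {a..b} u" using u intervals_from_Icc[OF I b] continuous_on_subset by blast
      then show "continuous_on {a..b} (frac_integral_pt a \<beta> u)"
        using False be by (intro frac_integral_pt_continuous bounded_measurable_continuous) auto
    qed
  qed
  then show ?thesis unfolding frac_integral_def by (rule continuous_version_eq[OF I _ t])
qed

section \<open>The integral of order 1: derivative, absolute continuity and fundamental
  theorem\<close>

lemma frac_integral_pt_1_has_derivative:
  assumes g: "bounded_measurable {a..b} g"
  obtains N where "negligible N" "\<And>t. t \<in> {a<..<b} - N \<Longrightarrow> (frac_integral_pt a 1 g has_real_derivative g t) (at t)"
proof -
  obtain h M N where h: "h \<in> borel_measurable borel" "\<And>s. \<bar>h s\<bar> \<le> M" "\<And>s. s < a \<Longrightarrow> h s = 0"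
    "negligible N" "\<And>s. s \<in> {a..b} - N \<Longrightarrow> h s = g s"
    "\<And>\<alpha> t. 0 < \<alpha> \<Longrightarrow> t \<in> {a..b} \<Longrightarrow> frac_integral_pt a \<alpha> g t = frac_conv \<alpha> h t"
    using frac_integral_pt_conv[OF g] by metis
  obtain N1 where N1: "negligible N1" "\<And>t. t \<notin> N1 \<Longrightarrow> (frac_conv 1 h has_real_derivative h t) (at t)"
    using frac_conv_1_has_derivative[OF h(1-3)] by metis
  show ?thesis
  proof (rule that[of "N \<union> N1"])
    show "negligible (N \<union> N1)" using h(4) N1(1) by auto
    fix t assume t: "t \<in> {a<..<b} - (N \<union> N1)"
    have "(frac_integral_pt a 1 g has_real_derivative h t) (at t)"
      by (rule has_field_derivative_transform_within_open[OF N1(2), of _ "{a<..<b}"]) (use t h(6) in auto)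
    then show "(frac_integral_pt a 1 g has_real_derivative g t) (at t)" using h(5)[of t] t by auto
  qed
qed

lemma frac_integral_pt_1_abs_continuous:
  assumes g: "bounded_measurable {a..b} g" and c: "{c..d} \<subseteq> {a..b}"
  shows "abs_continuous_on {c..d} (frac_integral_pt a 1 g)"
proof -
  obtain h M N where h: "h \<in> borel_measurable borel" "\<And>s. \<bar>h s\<bar> \<le> M" "\<And>s. s < a \<Longrightarrow> h s = 0"
    "\<And>\<alpha> t. 0 < \<alpha> \<Longrightarrow> t \<in> {a..b} \<Longrightarrow> frac_integral_pt a \<alpha> g t = frac_conv \<alpha> h t"
    using frac_integral_pt_conv[OF g] by metis
  show ?thesis
  proof (rule abs_continuous_on_Lipschitz)
    fix x y assume "x \<in> {c..d}" "y \<in> {c..d}" "x \<le> y"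
    moreover from this have "\<bar>frac_conv 1 h y - frac_conv 1 h x\<bar> \<le> M * (y - x)"
      by (intro frac_conv_1_Lipschitz[OF h(1-3)])
    ultimately show "\<bar>frac_integral_pt a 1 g y - frac_integral_pt a 1 g x\<bar> \<le> M * (y - x)"
      using h(4)[of 1 x] h(4)[of 1 y] subsetD[OF c, of x] subsetD[OF c, of y] by auto
  qed
qed

lemma frac_integral_pt_1_FTC:
  assumes g: "bounded_measurable {a..b} g" and ac: "abs_continuous_on {a..b} w" and N: "negligible N"
    and D: "\<And>t. t \<in> {a..b} - N \<Longrightarrow> (w has_real_derivative g t) (at t within {a..b})" and ab: "a \<le> b"
  shows "w b - w a = frac_integral_pt a 1 g b"
proof -
  obtain h M N' where h: "h \<in> borel_measurable borel" "\<And>s. \<bar>h s\<bar> \<le> M" "\<And>s. s < a \<Longrightarrow> h s = 0"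
    "negligible N'" "\<And>s. s \<in> {a..b} - N' \<Longrightarrow> h s = g s"
    "\<And>\<alpha> t. 0 < \<alpha> \<Longrightarrow> t \<in> {a..b} \<Longrightarrow> frac_integral_pt a \<alpha> g t = frac_conv \<alpha> h t"
    using frac_integral_pt_conv[OF g] by metis
  have "(g has_integral (w b - w a)) {a..b}"
    using ab ac N D by (rule abs_continuous_on_FTC)
  then have "(h has_integral (w b - w a)) {a..b}"
    using h(5) by (rule has_integral_spike[OF h(4), rotated])
  moreover have "(h has_integral (frac_conv 1 h b - frac_conv 1 h a)) {a..b}"
    by (rule frac_conv_1_diff[OF h(1-3) ab])
  moreover have "frac_conv 1 h a = 0" by (rule frac_conv_before[OF h(3)]) auto
  ultimately have "w b - w a = frac_conv 1 h b - 0" using has_integral_unique by metis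
  then show ?thesis using h(6)[of 1 b] ab by simp
qed

lemma abs_continuous_on_cong:
  assumes "\<And>t. t \<in> J \<Longrightarrow> u t = v t" and u: "abs_continuous_on J u"
  shows "abs_continuous_on J v"
  unfolding abs_continuous_on_def
proof (intro allI impI)
  fix e :: real assume "0 < e"
  then obtain d where d: "d > 0" "\<And>D S. D division_of S \<and> S \<subseteq> J \<and> (\<Sum>k\<in>D. Sup k - Inf k) < d
       \<Longrightarrow> (\<Sum>k\<in>D. \<bar>u (Sup k) - u (Inf k)\<bar>) < e"
    using u unfolding abs_continuous_on_def by blast
  have "(\<Sum>k\<in>D. \<bar>v (Sup k) - v (Inf k)\<bar>) = (\<Sum>k\<in>D. \<bar>u (Sup k) - u (Inf k)\<bar>)"
    if "D division_of S" "S \<subseteq> J" for D S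
  proof (rule sum.cong[OF refl])
    fix k assume k: "k \<in> D"
    have "Sup k \<in> J" "Inf k \<in> J" using division_endpoints(1,2)[OF that(1) k] that(2) by auto
    then show "\<bar>v (Sup k) - v (Inf k)\<bar> = \<bar>u (Sup k) - u (Inf k)\<bar>" using assms(1) by simp
  qed
  then show "\<exists>\<delta>>0. \<forall>D S. D division_of S \<and> S \<subseteq> J \<and> (\<Sum>k\<in>D. Sup k - Inf k) < \<delta>
       \<longrightarrow> (\<Sum>k\<in>D. \<bar>v (Sup k) - v (Inf k)\<bar>) < e"
    using d by (intro exI[of _ d]) auto
qed

section \<open>The integral form of the Caputo equation\<close>

text \<open>\<open>W\<close>, the integral of order \<open>1 - \<alpha>\<close> of
  \<open>q - q a\<close>, is absolutely continuous, starts at 0 and has derivative \<open>g\<close>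
  almost everywhere, so it is the indefinite integral of \<open>g\<close>; the complement lemma then
  raises the order by \<alpha>.\<close>

lemma has_caputo_deriv_imp_integral:
  assumes I: "I \<in> intervals_from a" and al: "0 < \<alpha>" "\<alpha> \<le> 1"
    and g: "\<And>b. b \<in> I \<Longrightarrow> bounded_measurable {a..b} g"
    and q: "has_caputo_deriv a \<alpha> I q g" and b: "b \<in> I"
  shows "q b = q a + frac_integral_pt a \<alpha> g b"
proof (cases "a < b")
  case False
  then have "b = a" using b I by (auto simp: intervals_from_def)
  then show ?thesis using frac_integral_pt_start[OF al(1)] by simp
next
  case True
  define u where "u t = q t - q a" for t
  define W where "W = frac_integral a (1 - \<alpha>) I u"
  have be: "0 \<le> 1 - \<alpha>" "1 - \<alpha> \<le> 1" using al by auto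
  have II: "is_interval I" "a \<in> I" using I by (auto simp: intervals_from_def)
  have sub: "{a..b} \<subseteq> I" by (rule intervals_from_Icc[OF I b])
  have u: "continuous_on I u" and ac: "W \<in> AC_loc I"
    and ae: "AE t in lebesgue_on I. (W has_real_derivative g t) (at t within I)"
    using q unfolding u_def W_def has_caputo_deriv_def caputo_AC_def has_RL_deriv_def RL_AC_def
    by (auto intro!: continuous_intros)
  obtain N where N: "negligible N" "\<And>t. t \<in> I - N \<Longrightarrow> (W has_real_derivative g t) (at t within I)"
    using ae AE_lebesgue_on_iff[OF interval_lebesgue[OF II(1)]] by auto
  have W: "W t = frac_integral_pt a (1 - \<alpha>) u t" if "t \<in> I" for t
    unfolding W_def by (rule frac_integral_eq_pt[OF I u be that])
  \<comment> \<open>For \<open>\<alpha> < 1\<close> this is an integral over a single point; for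
    \<open>\<alpha> = 1\<close> it holds because \<open>q a\<close> has been subtracted.\<close>
  have "W a = 0"
    unfolding W[OF II(2)] using frac_integral_pt_start[of "1 - \<alpha>" a u] al
    by (cases "\<alpha> = 1") (auto simp: frac_integral_pt_def u_def)
  have "W t = frac_integral_pt a 1 g t" if t: "t \<in> {a..b}" for t
  proof -
    have sub': "{a..t} \<subseteq> I" using sub t by auto
    have "W t - W a = frac_integral_pt a 1 g t"
    proof (rule frac_integral_pt_1_FTC[OF _ _ N(1)])
      show "bounded_measurable {a..t} g" using g sub t by blast
      show "abs_continuous_on {a..t} W" using ac sub' by (auto simp: AC_loc_def)
      show "(W has_real_derivative g s) (at s within {a..t})" if "s \<in> {a..t} - N" for s
      proof (rule DERIV_subset[OF N(2) sub'])
        show "s \<in> I - N" using that sub' by auto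
      qed
    qed (use t in auto)
    then show ?thesis using \<open>W a = 0\<close> by simp
  qed
  then have "\<forall>t\<in>{a..b}. frac_integral_pt a (1 - \<alpha>) u t = frac_integral_pt a 1 g t"
    using W subsetD[OF sub] by simp
  then have "u b = frac_integral_pt a \<alpha> g b"
    using frac_integral_pt_complement_iff[OF True al continuous_on_subset[OF u sub] g[OF b]] True by auto
  then show ?thesis by (simp add: u_def)
qed

text \<open>The complement lemma identifies \<open>W\<close> with the indefinite integral of
  \<open>g\<close> on all of \<open>I\<close>. That integral is Lipschitz on compact intervals and
  differentiable almost everywhere.\<close>

lemma frac_integral_imp_has_caputo_deriv:
  assumes I: "I \<in> intervals_from a" and al: "0 < \<alpha>" "\<alpha> \<le> 1"
    and g: "\<And>b. b \<in> I \<Longrightarrow> bounded_measurable {a..b} g"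
    and cont: "continuous_on I q" and q: "\<And>t. t \<in> I \<Longrightarrow> q t = q a + frac_integral_pt a \<alpha> g t"
  shows "has_caputo_deriv a \<alpha> I q g"
proof -
  define u where "u t = q t - q a" for t
  define W where "W = frac_integral a (1 - \<alpha>) I u"
  have be: "0 \<le> 1 - \<alpha>" "1 - \<alpha> \<le> 1" using al by auto
  have II: "is_interval I" "a \<in> I" "I \<subseteq> {a..}" using I by (auto simp: intervals_from_def)
  have u: "continuous_on I u" unfolding u_def using cont by (intro continuous_intros)
  have W: "W t = frac_integral_pt a 1 g t" if t: "t \<in> I" for t
  proof -
    \<comment> \<open>The complement lemma needs a nondegenerate interval; for \<open>t = a\<close>
      it is supplied by some other point of \<open>I\<close>.\<close>
    obtain b where b: "b \<in> I" "a < b" "t \<le> b"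
    proof (cases "a < t")
      case False
      have "{a} \<subset> I" using I by (auto simp: intervals_from_def)
      then obtain c where "c \<in> I - {a}" using psubset_imp_ex_mem by blast
      then show ?thesis using that[of c] False II by force
    qed (use t that in auto)
    have sub: "{a..b} \<subseteq> I" by (rule intervals_from_Icc[OF I b(1)])
    have "\<forall>s\<in>{a..b}. u s = frac_integral_pt a \<alpha> g s"
      using q sub by (auto simp: u_def)
    then have "\<forall>s\<in>{a..b}. frac_integral_pt a (1 - \<alpha>) u s = frac_integral_pt a 1 g s"
      using frac_integral_pt_complement_iff[OF b(2) al continuous_on_subset[OF u sub] g[OF b(1)]] by blast
    then show ?thesis
      unfolding W_def frac_integral_eq_pt[OF I u be t] using t b II by auto
  qed
  have ac: "W \<in> AC_loc I"
    unfolding AC_loc_def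
  proof (intro CollectI allI impI)
    fix c d assume cd: "{c..d} \<subseteq> I"
    show "abs_continuous_on {c..d} W"
    proof (cases "c \<le> d")
      case True
      then have d: "d \<in> I" "{c..d} \<subseteq> {a..d}" using cd II by auto
      show ?thesis
        by (rule abs_continuous_on_cong[OF _ frac_integral_pt_1_abs_continuous[OF g[OF d(1)] d(2)]])
           (use W cd in auto)
    next
      case False
      then show ?thesis by (intro abs_continuous_on_Lipschitz[where M=0]) auto
    qed
  qed
  have L1: "u \<in> L1_loc I"
    unfolding L1_loc_def using u
    by (auto intro!: absolutely_integrable_continuous_real continuous_on_subset[OF u])
  obtain C where C: "countable C" "C \<subseteq> I" "\<And>t. t \<in> I \<Longrightarrow> \<exists>c\<in>C. t \<le> c"
    using intervals_from_countable_cofinal[OF I] by blast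
  have "\<exists>N. negligible N \<and> (\<forall>t. t \<in> {a<..<c} - N \<longrightarrow> (frac_integral_pt a 1 g has_real_derivative g t) (at t))"
    if "c \<in> I" for c
    using frac_integral_pt_1_has_derivative[OF g[OF that]] by metis
  then obtain N where N: "\<And>c. c \<in> I \<Longrightarrow> negligible (N c)"
    "\<And>c t. c \<in> I \<Longrightarrow> t \<in> {a<..<c} - N c \<Longrightarrow> (frac_integral_pt a 1 g has_real_derivative g t) (at t)"
    by metis
  \<comment> \<open>The end points join the exceptional set because the derivative on
    \<open>{a..c}\<close> is known only in the interior.\<close>
  have "negligible (\<Union>c\<in>C. N c \<union> {c})"
    using C N(1) by (intro negligible_countable_Union) auto
  then have neg: "negligible ((\<Union>c\<in>C. N c \<union> {c}) \<union> {a})" by (intro negligible_Un) auto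
  have "(W has_real_derivative g t) (at t within I)" if t: "t \<in> I - ((\<Union>c\<in>C. N c \<union> {c}) \<union> {a})" for t
  proof -
    obtain c where c: "c \<in> C" "t \<le> c" using C(3)[of t] t by auto
    have "t \<noteq> c" "t \<noteq> a" "t \<notin> N c" "t \<in> I" using t c(1) by auto
    then have tc: "t \<in> {a<..<c} - N c" using c(2) II(3) by auto
    have "(frac_integral_pt a 1 g has_real_derivative g t) (at t within I)"
      using subsetD[OF C(2) c(1)] tc by (rule has_field_derivative_at_within[OF N(2)])
    then show ?thesis
      by (rule has_field_derivative_transform_within[OF _ zero_less_one]) (use t W in auto)
  qed
  then have "AE t in lebesgue_on I. (W has_real_derivative g t) (at t within I)"
    unfolding AE_lebesgue_on_iff[OF interval_lebesgue[OF II(1)]] using neg by blast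
  then show ?thesis
    using cont ac L1 unfolding has_caputo_deriv_def caputo_AC_def has_RL_deriv_def RL_AC_def W_def u_def by auto
qed

lemma has_caputo_deriv_iff:
  assumes "I \<in> intervals_from a" "0 < \<alpha>" "\<alpha> \<le> 1"
    and "\<And>b. b \<in> I \<Longrightarrow> bounded_measurable {a..b} g"
  shows "has_caputo_deriv a \<alpha> I q g \<longleftrightarrow>
    continuous_on I q \<and> (\<forall>t\<in>I. q t = q a + frac_integral_pt a \<alpha> g t)"
proof
  assume L: "has_caputo_deriv a \<alpha> I q g"
  then show "continuous_on I q \<and> (\<forall>t\<in>I. q t = q a + frac_integral_pt a \<alpha> g t)"
    using has_caputo_deriv_imp_integral[OF assms L] by (auto simp: has_caputo_deriv_def caputo_AC_def)
qed (use frac_integral_imp_has_caputo_deriv[OF assms] in blast)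

section \<open>The Volterra operator\<close>

lemma frac_integral_pt_diff_exp_bound:
  assumes g1: "bounded_measurable {a..b} g1" and g2: "bounded_measurable {a..b} g2"
    and al: "0 < \<alpha>" and k: "0 < k" and B: "0 \<le> B"
    and diff: "\<And>s. s \<in> {a..b} \<Longrightarrow> \<bar>g1 s - g2 s\<bar> \<le> B * exp (k * (s - a))" and t: "t \<in> {a..b}"
  shows "\<bar>frac_integral_pt a \<alpha> g1 t - frac_integral_pt a \<alpha> g2 t\<bar> \<le> B * k powr (- \<alpha>) * exp (k * (t - a))"
proof -
  obtain h1 M1 N1 where h1: "h1 \<in> borel_measurable borel" "\<And>s. \<bar>h1 s\<bar> \<le> M1" "\<And>s. s < a \<Longrightarrow> h1 s = 0"
    "negligible N1" "\<And>s. s \<in> {a..b} - N1 \<Longrightarrow> h1 s = g1 s"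
    "\<And>\<alpha> t. 0 < \<alpha> \<Longrightarrow> t \<in> {a..b} \<Longrightarrow> frac_integral_pt a \<alpha> g1 t = frac_conv \<alpha> h1 t"
    using frac_integral_pt_conv[OF g1] by metis
  obtain h2 M2 N2 where h2: "h2 \<in> borel_measurable borel" "\<And>s. \<bar>h2 s\<bar> \<le> M2" "\<And>s. s < a \<Longrightarrow> h2 s = 0"
    "negligible N2" "\<And>s. s \<in> {a..b} - N2 \<Longrightarrow> h2 s = g2 s"
    "\<And>\<alpha> t. 0 < \<alpha> \<Longrightarrow> t \<in> {a..b} \<Longrightarrow> frac_integral_pt a \<alpha> g2 t = frac_conv \<alpha> h2 t"
    using frac_integral_pt_conv[OF g2] by metis
  note [measurable] = h1(1) h2(1)
  \<comment> \<open>The weighted bound on \<open>h1 - h2\<close> may fail on a null set; putting 0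
    there makes it hold at every \<open>s\<close> without changing the convolution.\<close>
  define h where "h s = (if \<bar>h1 s - h2 s\<bar> \<le> B * exp (k * (s - a)) then h1 s - h2 s else 0)" for s
  have h [measurable]: "h \<in> borel_measurable borel" unfolding h_def by measurable
  have hB: "\<bar>h s\<bar> \<le> B * exp (k * (s - a))" for s
    using mult_nonneg_nonneg[OF B exp_ge_zero] by (simp add: h_def)
  have i1: "integrable lborel (\<lambda>s. frac_kernel \<alpha> (t - s) * h1 s)"
    by (rule frac_conv_integrable[OF h1(1-3) al])
  have i2: "integrable lborel (\<lambda>s. frac_kernel \<alpha> (t - s) * h2 s)"
    by (rule frac_conv_integrable[OF h2(1-3) al])
  have "frac_integral_pt a \<alpha> g1 t - frac_integral_pt a \<alpha> g2 t = frac_conv \<alpha> h1 t - frac_conv \<alpha> h2 t"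
    using h1(6)[OF al t] h2(6)[OF al t] by simp
  also have "\<dots> = frac_conv \<alpha> (\<lambda>s. h1 s - h2 s) t"
    unfolding frac_conv_def right_diff_distrib by (rule Bochner_Integration.integral_diff[OF i1 i2, symmetric])
  also have "\<dots> = frac_conv \<alpha> h t"
  proof (rule frac_conv_cong_AE)
    show "negligible (N1 \<union> N2)" using h1(4) h2(4) by simp
    fix s assume s: "s < t" "s \<notin> N1 \<union> N2"
    show "h1 s - h2 s = h s"
    proof (cases "s < a")
      case True
      then have "h1 s = 0" "h2 s = 0" using h1(3) h2(3) by blast+
      then show ?thesis by (simp add: h_def)
    next
      case False
      then have "s \<in> {a..b}" using s t by auto
      then have "h1 s - h2 s = g1 s - g2 s" using h1(5)[of s] h2(5)[of s] s by simp
      then show ?thesis using diff[OF \<open>s \<in> {a..b}\<close>] by (simp add: h_def)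
    qed
  qed measurable
  finally have "frac_integral_pt a \<alpha> g1 t - frac_integral_pt a \<alpha> g2 t = frac_conv \<alpha> h t" .
  moreover have "\<bar>frac_conv \<alpha> h t\<bar> \<le> B * k powr (- \<alpha>) * exp (k * (t - a))"
    using h al k hB by (rule frac_conv_exp_bound)
  ultimately show ?thesis by (simp only:)
qed

text \<open>For a simple function in place of \<open>q\<close> the composition is a finite patchwork
  of the measurable functions \<open>f (x, t)\<close>. Continuity in \<open>x\<close> carries
  measurability to the pointwise limit.\<close>

lemma caratheodory_compose_measurable:
  fixes f :: "'a::{metric_space, second_countable_topology} \<times> 'b \<Rightarrow> 'c::metric_space"
  assumes f: "\<And>x. (\<lambda>t. f (x, t)) \<in> borel_measurable M"
    and cont: "\<And>t. t \<in> space M \<Longrightarrow> continuous_on UNIV (\<lambda>x. f (x, t))"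
    and q: "q \<in> borel_measurable M"
  shows "(\<lambda>t. f (q t, t)) \<in> borel_measurable M"
proof -
  obtain F where F: "\<And>i. simple_function M (F i)" "\<And>t. t \<in> space M \<Longrightarrow> (\<lambda>i. F i t) \<longlonglongrightarrow> q t"
    using borel_measurable_implies_sequence_metric[OF q, of undefined] by blast
  show ?thesis
  proof (rule borel_measurable_LIMSEQ_metric)
    fix i
    have fin: "finite (F i ` space M)" using F(1)[of i] by (simp add: simple_function_def)
    have "F i \<in> measurable M (count_space (F i ` space M))"
      using F(1)[of i] fin by (auto simp: measurable_count_space_eq2 simple_function_def)
    then show "(\<lambda>t. f (F i t, t)) \<in> borel_measurable M"
      by (rule measurable_compose_countable'[OF f _ countable_finite[OF fin]])
  next
    fix t assume t: "t \<in> space M"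
    have "isCont (\<lambda>x. f (x, t)) (q t)"
      using cont[OF t] by (simp add: continuous_on_eq_continuous_at)
    then show "(\<lambda>i. f (F i t, t)) \<longlonglongrightarrow> f (q t, t)"
      using F(2)[OF t] by (rule isCont_tendsto_compose)
  qed
qed

lemma continuous_diff_bound:
  fixes p r :: "real \<Rightarrow> 'b::real_normed_vector"
  assumes p: "continuous_on {a..b} p" and r: "continuous_on {a..b} r" and k: "0 < k"
  obtains A where "0 \<le> A" "\<And>t. t \<in> {a..b} \<Longrightarrow> norm (p t - r t) \<le> A * exp (k * (t - a))"
proof -
  have "bounded ((\<lambda>t. p t - r t) ` {a..b})"
    using p r by (intro compact_imp_bounded compact_continuous_image continuous_intros) auto
  then obtain A where A: "\<And>t. t \<in> {a..b} \<Longrightarrow> norm (p t - r t) \<le> A"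
    unfolding bounded_iff by blast
  have "norm (p t - r t) \<le> \<bar>A\<bar> * exp (k * (t - a))" if t: "t \<in> {a..b}" for t
  proof -
    have "norm (p t - r t) \<le> \<bar>A\<bar> * 1" using A[OF t] by simp
    also have "\<dots> \<le> \<bar>A\<bar> * exp (k * (t - a))" using k t by (intro mult_left_mono) auto
    finally show ?thesis .
  qed
  then show ?thesis using that[of "\<bar>A\<bar>"] by simp
qed

text \<open>The estimates hold at every time here, not almost everywhere; the last section reduces
  the given problem to this one. The bound at \<open>x = 0\<close> and the Lipschitz estimate
  together bound \<open>f\<close> along every continuous curve on a compact interval.\<close>

locale frac_cauchy_problem =
  fixes a :: real and J :: "real set" and f :: "(real ^ 'm) \<times> real \<Rightarrow> real ^ 'm" and \<alpha> qa :: "real ^ 'm"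
  assumes J: "J \<in> intervals_from a"
    and f_measurable: "\<And>x. (\<lambda>t. f (x, t)) \<in> borel_measurable (lebesgue_on J)"
    and f_Lipschitz: "\<And>b. b \<in> J \<Longrightarrow> \<exists>L\<ge>0. \<forall>t\<in>{a..b}. \<forall>x y. norm (f (y, t) - f (x, t)) \<le> L * norm (y - x)"
    and f_bounded: "\<And>b. b \<in> J \<Longrightarrow> \<exists>M. \<forall>t\<in>{a..b}. norm (f (0, t)) \<le> M"
    and orders: "\<And>i. 0 < \<alpha> $ i" "\<And>i. \<alpha> $ i \<le> 1"
begin

definition volterra :: "(real \<Rightarrow> real ^ 'm) \<Rightarrow> real \<Rightarrow> real ^ 'm" where
  "volterra q t = (\<chi> i. qa $ i + frac_integral_pt a (\<alpha> $ i) (\<lambda>s. f (q s, s) $ i) t)"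

lemma volterra_start: "volterra q a = qa"
  using orders(1) by (simp add: volterra_def frac_integral_pt_start vec_eq_iff)

lemma rhs_bounded_measurable:
  assumes b: "b \<in> J" and q: "continuous_on {a..b} q"
  shows "bounded_measurable {a..b} (\<lambda>t. f (q t, t) $ i)"
  unfolding bounded_measurable_def
proof
  have sub: "{a..b} \<subseteq> J" by (rule intervals_from_Icc[OF J b])
  obtain L where L: "0 \<le> L" "\<And>t x y. t \<in> {a..b} \<Longrightarrow> norm (f (y, t) - f (x, t)) \<le> L * norm (y - x)"
    using f_Lipschitz[OF b] by blast
  have "(\<lambda>t. f (q t, t)) \<in> borel_measurable (lebesgue_on {a..b})"
  proof (rule caratheodory_compose_measurable)
    show "(\<lambda>t. f (x, t)) \<in> borel_measurable (lebesgue_on {a..b})" for x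
      using measurable_restrict_mono[OF f_measurable sub] .
    show "q \<in> borel_measurable (lebesgue_on {a..b})"
      using q by (intro continuous_imp_measurable_on_sets_lebesgue) auto
    fix t assume "t \<in> space (lebesgue_on {a..b})"
    then have "L-lipschitz_on UNIV (\<lambda>x. f (x, t))"
      using L by (intro lipschitz_onI) (auto simp: dist_norm norm_minus_commute)
    then show "continuous_on UNIV (\<lambda>x. f (x, t))" by (rule lipschitz_on_continuous_on)
  qed
  then show "(\<lambda>t. f (q t, t) $ i) \<in> borel_measurable (lebesgue_on {a..b})"
    by (rule measurable_compose) (intro borel_measurable_continuous_onI continuous_intros)
  obtain M where M: "\<And>t. t \<in> {a..b} \<Longrightarrow> norm (f (0, t)) \<le> M"
    using f_bounded[OF b] by blast
  have "bounded (q ` {a..b})"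
    using q by (intro compact_imp_bounded compact_continuous_image) auto
  then obtain R where R: "\<And>t. t \<in> {a..b} \<Longrightarrow> norm (q t) \<le> R"
    unfolding bounded_iff by blast
  have "\<bar>f (q t, t) $ i\<bar> \<le> M + L * R" if t: "t \<in> {a..b}" for t
  proof -
    have "\<bar>f (q t, t) $ i\<bar> \<le> norm (f (q t, t))" by (rule component_le_norm_cart)
    also have "\<dots> \<le> norm (f (0, t)) + norm (f (q t, t) - f (0, t))" by (rule norm_triangle_sub)
    also have "\<dots> \<le> M + L * norm (q t - 0)" by (intro add_mono M L t)
    also have "\<dots> \<le> M + L * R" using R[OF t] L(1) by (simp add: mult_left_mono)
    finally show ?thesis .
  qed
  then show "\<exists>M. \<forall>t\<in>{a..b}. \<bar>f (q t, t) $ i\<bar> \<le> M" by blast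
qed

lemma volterra_continuous:
  assumes "b \<in> J" "continuous_on {a..b} q"
  shows "continuous_on {a..b} (volterra q)"
  unfolding volterra_def
  by (intro continuous_on_vec_lambda continuous_on_add continuous_on_const
      frac_integral_pt_continuous[OF rhs_bounded_measurable[OF assms] orders])

text \<open>The Volterra equation contains the initial condition: at \<open>t = a\<close> the
  fractional integrals vanish.\<close>

lemma local_solution_iff:
  assumes I: "I \<in> intervals_from a" and IJ: "I \<subseteq> J"
  shows "local_solution a J f \<alpha> qa q I \<longleftrightarrow> continuous_on I q \<and> (\<forall>t\<in>I. q t = volterra q t)"
proof -
  have aI: "a \<in> I" using I by (auto simp: intervals_from_def)
  have bm: "bounded_measurable {a..b} (\<lambda>t. f (q t, t) $ i)" if "continuous_on I q" "b \<in> I" for b i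
    using rhs_bounded_measurable[of b q i] that IJ intervals_from_Icc[OF I that(2)] continuous_on_subset by blast
  have eq: "q t = volterra q t \<longleftrightarrow> (\<forall>i. q t $ i = q a $ i + frac_integral_pt a (\<alpha> $ i) (\<lambda>s. f (q s, s) $ i) t)"
    if "q a = qa" for t
    using that by (simp add: vec_eq_iff volterra_def)
  have iff: "has_caputo_deriv a (\<alpha> $ i) I (\<lambda>t. q t $ i) (\<lambda>t. f (q t, t) $ i) \<longleftrightarrow>
      continuous_on I (\<lambda>t. q t $ i) \<and> (\<forall>t\<in>I. q t $ i = q a $ i + frac_integral_pt a (\<alpha> $ i) (\<lambda>s. f (q s, s) $ i) t)"
    if "continuous_on I q" for i
    by (rule has_caputo_deriv_iff[OF I orders bm[OF that]])
  show ?thesis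
  proof
    assume sol: "local_solution a J f \<alpha> qa q I"
    then have "continuous_on I (\<lambda>t. q t $ i)" for i
      by (auto simp: local_solution_def caputo_AC_def)
    then have "continuous_on I (\<lambda>t. \<chi> i. q t $ i)" by (intro continuous_on_vec_lambda)
    then have q: "continuous_on I q" by simp
    have "q a = qa" using sol by (simp add: local_solution_def)
    then show "continuous_on I q \<and> (\<forall>t\<in>I. q t = volterra q t)"
      using sol q iff[OF q] eq by (auto simp: local_solution_def)
  next
    assume R: "continuous_on I q \<and> (\<forall>t\<in>I. q t = volterra q t)"
    then have qa: "q a = qa" using aI volterra_start by auto
    have "continuous_on I (\<lambda>t. q t $ i)" for i using R by (intro continuous_intros) auto
    then have "has_caputo_deriv a (\<alpha> $ i) I (\<lambda>t. q t $ i) (\<lambda>t. f (q t, t) $ i)" for i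
      using R iff eq[OF qa] by blast
    then show "local_solution a J f \<alpha> qa q I"
      using I IJ qa by (auto simp: local_solution_def has_caputo_deriv_def)
  qed
qed

text \<open>Bielecki's trick: in the norm weighted by \<open>exp (- k * (t - a))\<close> the fractional integral of
  order \<open>\<alpha>\<close> has norm at most \<open>k powr - \<alpha>\<close>, so for large \<open>k\<close> the Volterra operator is a contraction
  on every compact interval, whatever its length.\<close>

lemma volterra_contraction:
  assumes b: "b \<in> J"
  obtains k where "0 < k" "\<And>p r A t. continuous_on {a..b} p \<Longrightarrow> continuous_on {a..b} r \<Longrightarrow>
    (\<And>s. s \<in> {a..b} \<Longrightarrow> norm (p s - r s) \<le> A * exp (k * (s - a))) \<Longrightarrow> t \<in> {a..b} \<Longrightarrow>
    norm (volterra p t - volterra r t) \<le> A / 2 * exp (k * (t - a))"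
proof -
  obtain L where L: "0 \<le> L" "\<And>t x y. t \<in> {a..b} \<Longrightarrow> norm (f (y, t) - f (x, t)) \<le> L * norm (y - x)"
    using f_Lipschitz[OF b] by blast
  \<comment> \<open>Each component has its own order, hence its own factor. One \<open>k\<close>
    must make their sum small, since the Euclidean norm is bounded below by the sum of the absolute
    values of the components; every term tends to 0 because the orders are positive.\<close>
  have "((\<lambda>k. \<Sum>i\<in>UNIV. L * k powr (- \<alpha> $ i)) \<longlongrightarrow> (\<Sum>i\<in>(UNIV :: 'm set). L * 0)) at_top"
    using orders(1) by (intro tendsto_sum tendsto_mult tendsto_const tendsto_neg_powr filterlim_ident) auto
  then have "\<forall>\<^sub>F k in at_top. (\<Sum>i\<in>UNIV. L * k powr (- \<alpha> $ i)) < 1 / 2"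
    by (rule order_tendstoD(2)) simp
  then have "\<forall>\<^sub>F k in at_top. 0 < k \<and> (\<Sum>i\<in>UNIV. L * k powr (- \<alpha> $ i)) < 1 / 2"
    using eventually_gt_at_top[of "0::real"] by eventually_elim auto
  then obtain k where k: "0 < k" "(\<Sum>i\<in>UNIV. L * k powr (- \<alpha> $ i)) < 1 / 2"
    using eventually_happens by force
  show ?thesis
  proof (rule that[OF k(1)])
    fix p r :: "real \<Rightarrow> real ^ 'm" and A t
    assume p: "continuous_on {a..b} p" and r: "continuous_on {a..b} r"
      and A: "\<And>s. s \<in> {a..b} \<Longrightarrow> norm (p s - r s) \<le> A * exp (k * (s - a))" and t: "t \<in> {a..b}"
    have "a \<in> {a..b}" using t by auto
    then have "norm (p a - r a) \<le> A" using A[of a] by simp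
    then have A0: "0 \<le> A" using norm_ge_zero[of "p a - r a"] by linarith
    have comp: "\<bar>(volterra p t - volterra r t) $ i\<bar> \<le> (L * A) * k powr (- \<alpha> $ i) * exp (k * (t - a))" for i
    proof -
      have "\<bar>f (p s, s) $ i - f (r s, s) $ i\<bar> \<le> (L * A) * exp (k * (s - a))" if s: "s \<in> {a..b}" for s
      proof -
        have "\<bar>f (p s, s) $ i - f (r s, s) $ i\<bar> \<le> norm (f (p s, s) - f (r s, s))"
          using component_le_norm_cart[of "f (p s, s) - f (r s, s)" i] by simp
        also have "\<dots> \<le> L * norm (p s - r s)" by (rule L(2)[OF s])
        also have "\<dots> \<le> L * (A * exp (k * (s - a)))" by (intro mult_left_mono A s L(1))
        finally show ?thesis by (simp add: mult.assoc)
      qed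
      then show ?thesis
        using frac_integral_pt_diff_exp_bound[OF rhs_bounded_measurable[OF b p] rhs_bounded_measurable[OF b r] orders(1) k(1) _ _ t, of "L * A" i i i] L(1) A0
        by (simp add: volterra_def)
    qed
    have "norm (volterra p t - volterra r t) \<le> (\<Sum>i\<in>UNIV. \<bar>(volterra p t - volterra r t) $ i\<bar>)"
      by (rule norm_le_l1_cart)
    also have "\<dots> \<le> (\<Sum>i\<in>UNIV. (L * A) * k powr (- \<alpha> $ i) * exp (k * (t - a)))"
      by (intro sum_mono comp)
    also have "\<dots> = (\<Sum>i\<in>UNIV. L * k powr (- \<alpha> $ i)) * (A * exp (k * (t - a)))"
      unfolding sum_distrib_right by (rule sum.cong) (simp_all add: mult_ac)
    also have "\<dots> \<le> 1 / 2 * (A * exp (k * (t - a)))"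
      using k(2) A0 by (intro mult_right_mono) auto
    finally show "norm (volterra p t - volterra r t) \<le> A / 2 * exp (k * (t - a))" by simp
  qed
qed

section \<open>Uniqueness of the fixed point and Picard iteration\<close>

lemma volterra_fixpoint_unique:
  assumes b: "b \<in> J" and p: "continuous_on {a..b} p" "\<And>t. t \<in> {a..b} \<Longrightarrow> p t = volterra p t"
    and r: "continuous_on {a..b} r" "\<And>t. t \<in> {a..b} \<Longrightarrow> r t = volterra r t" and t: "t \<in> {a..b}"
  shows "p t = r t"
proof -
  obtain k where k: "0 < k" "\<And>p r A t. continuous_on {a..b} p \<Longrightarrow> continuous_on {a..b} r \<Longrightarrow>
    (\<And>s. s \<in> {a..b} \<Longrightarrow> norm (p s - r s) \<le> A * exp (k * (s - a))) \<Longrightarrow> t \<in> {a..b} \<Longrightarrow>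
    norm (volterra p t - volterra r t) \<le> A / 2 * exp (k * (t - a))"
    by (rule volterra_contraction[OF b]) blast
  obtain A where A: "0 \<le> A" "\<And>t. t \<in> {a..b} \<Longrightarrow> norm (p t - r t) \<le> A * exp (k * (t - a))"
    by (rule continuous_diff_bound[OF p(1) r(1) k(1)]) blast
  have bound: "norm (p s - r s) \<le> A / 2 ^ n * exp (k * (s - a))" if "s \<in> {a..b}" for n s
    using that
  proof (induction n arbitrary: s)
    case 0
    then show ?case using A by simp
  next
    case (Suc n)
    then show ?case using k(2)[OF p(1) r(1) Suc.IH Suc.prems] p(2)[of s] r(2)[of s] by (simp add: mult.commute)
  qed
  have "(\<lambda>n. A / 2 ^ n * exp (k * (t - a))) \<longlonglongrightarrow> 0 * exp (k * (t - a))"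
    by (intro tendsto_mult LIMSEQ_divide_realpow_zero tendsto_const) auto
  then have "norm (p t - r t) \<le> 0 * exp (k * (t - a))"
    using bound[OF t] by (intro LIMSEQ_le_const) auto
  then show ?thesis by simp
qed

fun picard :: "nat \<Rightarrow> real \<Rightarrow> real ^ 'm" where
  "picard 0 = (\<lambda>_. qa)"
| "picard (Suc n) = volterra (picard n)"

lemma picard_continuous: "b \<in> J \<Longrightarrow> continuous_on {a..b} (picard n)"
  by (induction n) (auto intro: volterra_continuous)

text \<open>A pointwise limit that mentions no compact interval, so one function serves all of
  \<open>J\<close> although the rate of convergence depends on the interval.\<close>

definition picard_limit :: "real \<Rightarrow> real ^ 'm" where
  "picard_limit t = lim (\<lambda>n. picard n t)"

lemma picard_limit_on_compact:
  assumes b: "b \<in> J"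
  shows "continuous_on {a..b} picard_limit \<and> (\<forall>t\<in>{a..b}. picard_limit t = volterra picard_limit t)"
proof -
  obtain k where k: "0 < k" "\<And>p r A t. continuous_on {a..b} p \<Longrightarrow> continuous_on {a..b} r \<Longrightarrow>
    (\<And>s. s \<in> {a..b} \<Longrightarrow> norm (p s - r s) \<le> A * exp (k * (s - a))) \<Longrightarrow> t \<in> {a..b} \<Longrightarrow>
    norm (volterra p t - volterra r t) \<le> A / 2 * exp (k * (t - a))"
    by (rule volterra_contraction[OF b]) blast
  obtain A where A: "0 \<le> A" "\<And>t. t \<in> {a..b} \<Longrightarrow> norm (picard (Suc 0) t - picard 0 t) \<le> A * exp (k * (t - a))"
    by (rule continuous_diff_bound[OF picard_continuous[OF b] picard_continuous[OF b] k(1)]) blast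
  have step: "norm (picard (Suc n) t - picard n t) \<le> A / 2 ^ n * exp (k * (t - a))" if "t \<in> {a..b}" for n t
    using that
  proof (induction n arbitrary: t)
    case 0
    then show ?case using A by simp
  next
    case (Suc n)
    then show ?case
      using k(2)[OF picard_continuous[OF b] picard_continuous[OF b] Suc.IH Suc.prems]
      by (simp add: mult.commute)
  qed
  \<comment> \<open>The subtracted tail of the geometric series makes the induction close exactly:
    each step adds \<open>A / 2 ^ (n + m)\<close>, half of the tail
    \<open>2 * A / 2 ^ (n + m)\<close>.\<close>
  have far: "norm (picard (n + m) t - picard n t) \<le> (2 * A / 2 ^ n - 2 * A / 2 ^ (n + m)) * exp (k * (t - a))"
    if t: "t \<in> {a..b}" for n m t
  proof (induction m)
    case (Suc m)
    have "norm (picard (n + Suc m) t - picard n t) \<le>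
        norm (picard (Suc (n + m)) t - picard (n + m) t) + norm (picard (n + m) t - picard n t)"
      using norm_triangle_ineq[of "picard (Suc (n + m)) t - picard (n + m) t" "picard (n + m) t - picard n t"] by simp
    also have "\<dots> \<le> A / 2 ^ (n + m) * exp (k * (t - a)) + (2 * A / 2 ^ n - 2 * A / 2 ^ (n + m)) * exp (k * (t - a))"
      by (intro add_mono step t Suc.IH)
    also have "\<dots> = (2 * A / 2 ^ n - 2 * A / 2 ^ (n + Suc m)) * exp (k * (t - a))"
      by (simp add: field_simps)
    finally show ?case .
  qed simp
  have far': "norm (picard (n + m) t - picard n t) \<le> 2 * A / 2 ^ n * exp (k * (t - a))" if t: "t \<in> {a..b}" for n m t
  proof -
    have "(2 * A / 2 ^ n - 2 * A / 2 ^ (n + m)) * exp (k * (t - a)) \<le> 2 * A / 2 ^ n * exp (k * (t - a))"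
      using A(1) by (intro mult_right_mono) auto
    then show ?thesis using far[OF t, of n m] by linarith
  qed
  have null: "(\<lambda>n. 2 * A / 2 ^ n * exp (k * c)) \<longlonglongrightarrow> 0" for c
    using tendsto_mult[OF LIMSEQ_divide_realpow_zero[of 2 "2 * A"] tendsto_const[of "exp (k * c)"]] by simp
  have lim: "(\<lambda>n. picard n t) \<longlonglongrightarrow> picard_limit t" if t: "t \<in> {a..b}" for t
  proof -
    have "Cauchy (\<lambda>n. picard n t)"
      unfolding Cauchy_altdef2
    proof (intro allI impI)
      fix e :: real assume "0 < e"
      then have "\<forall>\<^sub>F n in sequentially. 2 * A / 2 ^ n * exp (k * (t - a)) < e"
        using null[of "t - a"] by (rule order_tendstoD(2)[rotated])
      then obtain n where n: "2 * A / 2 ^ n * exp (k * (t - a)) < e"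
        by (auto simp: eventually_sequentially)
      have "dist (picard i t) (picard n t) < e" if "n \<le> i" for i
        using far'[OF t, of n "i - n"] n that by (simp add: dist_norm)
      then show "\<exists>N. \<forall>n\<ge>N. dist (picard n t) (picard N t) < e" by blast
    qed
    then show ?thesis
      unfolding picard_limit_def by (simp add: Cauchy_convergent_iff convergent_LIMSEQ_iff)
  qed
  have close: "norm (picard n t - picard_limit t) \<le> 2 * A / 2 ^ n * exp (k * (t - a))" if t: "t \<in> {a..b}" for n t
  proof -
    have "(\<lambda>m. picard (n + m) t) \<longlonglongrightarrow> picard_limit t"
      using LIMSEQ_ignore_initial_segment[OF lim[OF t], of n] by (simp add: add.commute)
    then have "(\<lambda>m. picard (n + m) t - picard n t) \<longlonglongrightarrow> picard_limit t - picard n t"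
      by (intro tendsto_intros)
    then have "norm (picard_limit t - picard n t) \<le> 2 * A / 2 ^ n * exp (k * (t - a))"
      by (rule Lim_norm_ubound[OF sequentially_bot]) (use far'[OF t] in auto)
    then show ?thesis by (simp add: norm_minus_commute)
  qed
  have "uniform_limit {a..b} picard picard_limit sequentially"
  proof (rule uniform_limitI)
    fix e :: real assume "0 < e"
    then have "\<forall>\<^sub>F n in sequentially. 2 * A / 2 ^ n * exp (k * (b - a)) < e"
      using null[of "b - a"] by (rule order_tendstoD(2)[rotated])
    then show "\<forall>\<^sub>F n in sequentially. \<forall>t\<in>{a..b}. dist (picard n t) (picard_limit t) < e"
    proof eventually_elim
      case (elim n)
      show ?case
      proof
        fix t assume t: "t \<in> {a..b}"
        \<comment> \<open>On a compact interval the weight is at most its value at \<open>b\<close>,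
          so weighted closeness becomes uniform.\<close>
        have "2 * A / 2 ^ n * exp (k * (t - a)) \<le> 2 * A / 2 ^ n * exp (k * (b - a))"
          using t k(1) A(1) by (intro mult_left_mono) auto
        then show "dist (picard n t) (picard_limit t) < e"
          using close[OF t, of n] elim by (simp add: dist_norm)
      qed
    qed
  qed
  then have cont: "continuous_on {a..b} picard_limit"
    by (rule uniform_limit_theorem[rotated]) (auto intro!: always_eventually picard_continuous[OF b])
  have "picard_limit t = volterra picard_limit t" if t: "t \<in> {a..b}" for t
  proof -
    have "norm (picard (Suc n) t - volterra picard_limit t) \<le> 2 * A / 2 ^ n * exp (k * (t - a))" for n
    proof -
      have "norm (picard (Suc n) t - volterra picard_limit t) \<le> (2 * A / 2 ^ n) / 2 * exp (k * (t - a))"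
        using k(2)[OF picard_continuous[OF b] cont close t] by simp
      also have "\<dots> \<le> 2 * A / 2 ^ n * exp (k * (t - a))"
        using A(1) by (intro mult_right_mono) (auto simp: field_simps)
      finally show ?thesis .
    qed
    then have "(\<lambda>n. picard (Suc n) t - volterra picard_limit t) \<longlonglongrightarrow> 0"
      by (intro Lim_null_comparison[OF _ null[of "t - a"]] always_eventually allI)
    then have "(\<lambda>n. picard (Suc n) t) \<longlonglongrightarrow> volterra picard_limit t"
      by (rule LIM_zero_cancel)
    moreover have "(\<lambda>n. picard (Suc n) t) \<longlonglongrightarrow> picard_limit t"
      using lim[OF t] by (rule LIMSEQ_Suc)
    ultimately show ?thesis using LIMSEQ_unique by blast
  qed
  then show ?thesis using cont by blast
qed

lemma picard_limit_solution: "local_solution a J f \<alpha> qa picard_limit J"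
proof -
  have "continuous_on J picard_limit"
    by (rule continuous_on_intervals_from[OF J]) (use picard_limit_on_compact in blast)
  moreover have "picard_limit t = volterra picard_limit t" if "t \<in> J" for t
  proof -
    have "t \<in> {a..t}" using that J by (auto simp: intervals_from_def)
    then show ?thesis using picard_limit_on_compact[OF that] by blast
  qed
  ultimately show ?thesis
    unfolding local_solution_iff[OF J order_refl] by blast
qed

lemma local_solution_unique:
  assumes p: "local_solution a J f \<alpha> qa p I" and r: "local_solution a J f \<alpha> qa r I'"
    and t: "t \<in> I" "t \<in> I'"
  shows "p t = r t"
proof -
  have I: "I \<in> intervals_from a" "I \<subseteq> J" and I': "I' \<in> intervals_from a" "I' \<subseteq> J"
    using p r by (auto simp: local_solution_def)
  have sub: "{a..t} \<subseteq> I" "{a..t} \<subseteq> I'"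
    using intervals_from_Icc I(1) I'(1) t by blast+
  have "continuous_on I p" "continuous_on I' r" "\<And>s. s \<in> {a..t} \<Longrightarrow> p s = volterra p s"
    "\<And>s. s \<in> {a..t} \<Longrightarrow> r s = volterra r s"
    using p r sub local_solution_iff[OF I] local_solution_iff[OF I'] by blast+
  moreover have "t \<in> {a..t}" using t I(1) by (auto simp: intervals_from_def)
  moreover have "t \<in> J" using t I by auto
  ultimately show ?thesis
    using volterra_fixpoint_unique[of t p r t] continuous_on_subset[OF _ sub(1)] continuous_on_subset[OF _ sub(2)] by blast
qed

text \<open>A solution on all of \<open>J\<close> cannot be enlarged, as domains lie in
  \<open>J\<close>. By uniqueness it extends any other maximal solution, whose maximality then
  forces the domain to be \<open>J\<close>.\<close>

lemma picard_limit_maximal: "the_maximal_solution a J f \<alpha> qa picard_limit J"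
  unfolding the_maximal_solution_def
proof (intro conjI[OF _ allI[OF allI[OF impI]]])
  show "maximal_solution a J f \<alpha> qa picard_limit J"
    using picard_limit_solution
    by (auto simp: maximal_solution_def extends_solution_def local_solution_def)
  fix r I assume r: "maximal_solution a J f \<alpha> qa r I"
  then have sol: "local_solution a J f \<alpha> qa r I" by (simp add: maximal_solution_def)
  have eq: "picard_limit t = r t" if "t \<in> I" for t
    using that sol local_solution_unique[OF picard_limit_solution sol] by (auto simp: local_solution_def)
  have "extends_solution a J f \<alpha> qa picard_limit J r I"
    using sol picard_limit_solution eq by (auto simp: extends_solution_def local_solution_def)
  then have "J = I" using r by (simp add: maximal_solution_def)
  then show "I = J \<and> (\<forall>t\<in>J. r t = picard_limit t)" using eq by auto
qed

end

section \<open>Removal of the exceptional null set\<close>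

lemma Lipschitz_bound_from_dense:
  fixes g :: "'a::real_normed_vector \<Rightarrow> 'b::real_normed_vector"
  assumes D: "\<And>X. open X \<Longrightarrow> X \<noteq> {} \<Longrightarrow> \<exists>d\<in>D. d \<in> X" and g: "continuous_on UNIV g"
    and L: "\<And>x y. x \<in> D \<Longrightarrow> y \<in> D \<Longrightarrow> norm (g y - g x) \<le> L * norm (y - x)"
  shows "norm (g y - g x) \<le> L * norm (y - x)"
proof -
  have dense: "\<exists>X. (\<forall>n. X n \<in> D) \<and> X \<longlonglongrightarrow> z" for z
  proof -
    have "z \<in> closure D"
    proof (rule ccontr)
      assume "z \<notin> closure D"
      then obtain d where "d \<in> D" "d \<in> - closure D" using D[of "- closure D"] by auto
      then show False using closure_subset by blast
    qed
    then show ?thesis by (simp add: closure_sequential)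
  qed
  obtain X Y where X: "\<And>n. X n \<in> D" "X \<longlonglongrightarrow> x" and Y: "\<And>n. Y n \<in> D" "Y \<longlonglongrightarrow> y"
    using dense[of x] dense[of y] by blast
  have "isCont g z" for z using g by (simp add: continuous_on_eq_continuous_at)
  then have "(\<lambda>n. g (X n)) \<longlonglongrightarrow> g x" "(\<lambda>n. g (Y n)) \<longlonglongrightarrow> g y"
    using X(2) Y(2) by (auto intro: isCont_tendsto_compose)
  then have "(\<lambda>n. norm (g (Y n) - g (X n))) \<longlonglongrightarrow> norm (g y - g x)"
    "(\<lambda>n. L * norm (Y n - X n)) \<longlonglongrightarrow> L * norm (y - x)"
    using X(2) Y(2) by (auto intro!: tendsto_intros)
  then show ?thesis
    by (rule LIMSEQ_le) (use L X(1) Y(1) in auto)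
qed

text \<open>The hypothesis allows a different null set for each pair of points. Pairs from a
  countable dense set need only countably many null sets, and continuity in \<open>x\<close> extends
  the estimate to all pairs.\<close>

lemma Lipschitz_everywhere_AE:
  fixes f :: "('a::{real_normed_vector, second_countable_topology}) \<times> 't \<Rightarrow> 'b::real_normed_vector"
  assumes cont: "AE t in M. continuous_on UNIV (\<lambda>x. f (x, t))"
    and L: "\<And>x y. AE t in M. norm (f (y, t) - f (x, t)) \<le> L * norm (y - x)"
  shows "AE t in M. \<forall>x y. norm (f (y, t) - f (x, t)) \<le> L * norm (y - x)"
proof -
  obtain D :: "'a set" where D: "countable D" "\<And>X. open X \<Longrightarrow> X \<noteq> {} \<Longrightarrow> \<exists>d\<in>D. d \<in> X"
    by (rule countable_dense_setE) blast
  have "AE t in M. \<forall>x\<in>D. \<forall>y\<in>D. norm (f (y, t) - f (x, t)) \<le> L * norm (y - x)"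
    using L D(1) by (simp add: AE_ball_countable)
  with cont show ?thesis
  proof eventually_elim
    case (elim t)
    then show ?case using Lipschitz_bound_from_dense[OF D(2), where g="\<lambda>x. f (x, t)"] by blast
  qed
qed

lemma AE_lebesgue_on_subset:
  assumes "AE t in lebesgue_on S. P t" "T \<subseteq> S" "S \<in> sets lebesgue" "T \<in> sets lebesgue"
  shows "AE t in lebesgue_on T. P t"
proof -
  obtain N where "negligible N" "\<forall>t\<in>S - N. P t"
    using assms(1) AE_lebesgue_on_iff[OF assms(3), of P] by auto
  then have "negligible N \<and> (\<forall>t\<in>T - N. P t)" using assms(2) by auto
  then show ?thesis using AE_lebesgue_on_iff[OF assms(4), of P] by auto
qed

text \<open>The constants may depend on \<open>b\<close>, but the null set must not:
  \<open>f\<close> is to be altered once and for all.\<close>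

lemma exceptional_null_set:
  fixes f :: "(real ^ 'm) \<times> real \<Rightarrow> real ^ 'm"
  assumes J: "J \<in> intervals_from a" and f: "caratheodory J f"
    and bdd: "\<forall>K c d. compact K \<and> {c..d} \<subseteq> J \<longrightarrow>
           (\<exists>M\<ge>0. \<forall>x\<in>K. AE t in lebesgue_on {c..d}. norm (f (x, t)) \<le> M)"
    and Lip: "\<forall>c d. {c..d} \<subseteq> J \<longrightarrow>
           (\<exists>L\<ge>0. \<forall>x\<^sub>1 x\<^sub>2. AE t in lebesgue_on {c..d}.
              norm (f (x\<^sub>2, t) - f (x\<^sub>1, t)) \<le> L * norm (x\<^sub>2 - x\<^sub>1))"
  obtains N where "negligible N"
    "\<And>b. b \<in> J \<Longrightarrow> \<exists>L\<ge>0. \<forall>t\<in>{a..b} - N. \<forall>x y. norm (f (y, t) - f (x, t)) \<le> L * norm (y - x)"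
    "\<And>b. b \<in> J \<Longrightarrow> \<exists>M\<ge>0. \<forall>t\<in>{a..b} - N. norm (f (0, t)) \<le> M"
proof -
  have Jl: "J \<in> sets lebesgue" using J by (intro interval_lebesgue) (auto simp: intervals_from_def)
  have "\<exists>N. negligible N \<and>
    (\<exists>L\<ge>0. \<forall>t\<in>{a..c} - N. \<forall>x y. norm (f (y, t) - f (x, t)) \<le> L * norm (y - x)) \<and>
    (\<exists>M\<ge>0. \<forall>t\<in>{a..c} - N. norm (f (0, t)) \<le> M)" if c: "c \<in> J" for c
  proof -
    have sub: "{a..c} \<subseteq> J" by (rule intervals_from_Icc[OF J c])
    obtain L where L: "0 \<le> L" "\<And>x y. AE t in lebesgue_on {a..c}. norm (f (y, t) - f (x, t)) \<le> L * norm (y - x)"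
      using Lip sub by blast
    have "compact {0 :: real ^ 'm}" by simp
    then obtain M where M: "0 \<le> M" "AE t in lebesgue_on {a..c}. norm (f (0, t)) \<le> M"
      using bdd sub by blast
    have "AE t in lebesgue_on J. continuous_on UNIV (\<lambda>x. f (x, t))"
      using f by (simp add: caratheodory_def)
    then have "AE t in lebesgue_on {a..c}. continuous_on UNIV (\<lambda>x. f (x, t))"
      by (rule AE_lebesgue_on_subset[OF _ sub Jl]) auto
    then have "AE t in lebesgue_on {a..c}. \<forall>x y. norm (f (y, t) - f (x, t)) \<le> L * norm (y - x)"
      using L(2) by (rule Lipschitz_everywhere_AE)
    with M(2) have "AE t in lebesgue_on {a..c}. (\<forall>x y. norm (f (y, t) - f (x, t)) \<le> L * norm (y - x)) \<and> norm (f (0, t)) \<le> M"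
      by eventually_elim blast
    then obtain N where "negligible N" "\<forall>t\<in>{a..c} - N. (\<forall>x y. norm (f (y, t) - f (x, t)) \<le> L * norm (y - x)) \<and> norm (f (0, t)) \<le> M"
      unfolding AE_lebesgue_on_iff[OF interval_lebesgue[OF is_interval_cc]] by blast
    then show ?thesis using L(1) M(1) by blast
  qed
  then obtain N where N: "\<And>c. c \<in> J \<Longrightarrow> negligible (N c)"
    "\<And>c. c \<in> J \<Longrightarrow> \<exists>L\<ge>0. \<forall>t\<in>{a..c} - N c. \<forall>x y. norm (f (y, t) - f (x, t)) \<le> L * norm (y - x)"
    "\<And>c. c \<in> J \<Longrightarrow> \<exists>M\<ge>0. \<forall>t\<in>{a..c} - N c. norm (f (0, t)) \<le> M"
    by metis
  obtain C where C: "countable C" "C \<subseteq> J" "\<And>t. t \<in> J \<Longrightarrow> \<exists>c\<in>C. t \<le> c"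
    using intervals_from_countable_cofinal[OF J] by blast
  show ?thesis
  proof (rule that[of "\<Union>c\<in>C. N c"])
    show "negligible (\<Union>c\<in>C. N c)"
      using C N(1) by (intro negligible_countable_Union) auto
    fix b assume b: "b \<in> J"
    obtain c where c: "c \<in> C" "b \<le> c" using C(3)[OF b] by blast
    then have cJ: "c \<in> J" using C(2) by blast
    have sub: "{a..b} - (\<Union>c\<in>C. N c) \<subseteq> {a..c} - N c"
      using c by auto
    show "\<exists>L\<ge>0. \<forall>t\<in>{a..b} - (\<Union>c\<in>C. N c). \<forall>x y. norm (f (y, t) - f (x, t)) \<le> L * norm (y - x)"
      using N(2)[OF cJ] sub by (meson subsetD)
    show "\<exists>M\<ge>0. \<forall>t\<in>{a..b} - (\<Union>c\<in>C. N c). norm (f (0, t)) \<le> M"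
      using N(3)[OF cJ] sub by (meson subsetD)
  qed
qed

lemma has_RL_deriv_cong_negligible:
  assumes I: "I \<in> sets lebesgue" and N: "negligible N" and eq: "\<And>t. t \<in> I - N \<Longrightarrow> g t = g' t"
  shows "has_RL_deriv a \<alpha> I q g \<longleftrightarrow> has_RL_deriv a \<alpha> I q g'"
proof -
  have "(AE t in lebesgue_on I. (W has_real_derivative g1 t) (at t within I))"
    if ae: "AE t in lebesgue_on I. (W has_real_derivative g2 t) (at t within I)" and eq12: "\<And>t. t \<in> I - N \<Longrightarrow> g2 t = g1 t" for W g1 g2
  proof -
    obtain N' where N': "negligible N'" "\<forall>t\<in>I - N'. (W has_real_derivative g2 t) (at t within I)"
      using ae unfolding AE_lebesgue_on_iff[OF I] by blast
    have "negligible (N \<union> N')" using N N' by simp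
    moreover have "\<forall>t\<in>I - (N \<union> N'). (W has_real_derivative g1 t) (at t within I)"
    proof
      fix t assume "t \<in> I - (N \<union> N')"
      then have "t \<in> I - N" "t \<in> I - N'" by auto
      then show "(W has_real_derivative g1 t) (at t within I)"
        using bspec[OF N'(2), of t] eq12[of t] by simp
    qed
    ultimately show ?thesis unfolding AE_lebesgue_on_iff[OF I] by blast
  qed
  note deriv_cong = this
  show ?thesis
    unfolding has_RL_deriv_def
  proof (intro conj_cong refl iffI)
    assume "AE t in lebesgue_on I. (frac_integral a (1 - \<alpha>) I q has_real_derivative g t) (at t within I)"
    then show "AE t in lebesgue_on I. (frac_integral a (1 - \<alpha>) I q has_real_derivative g' t) (at t within I)"
      by (rule deriv_cong) (rule eq)
  next
    assume "AE t in lebesgue_on I. (frac_integral a (1 - \<alpha>) I q has_real_derivative g' t) (at t within I)"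
    then show "AE t in lebesgue_on I. (frac_integral a (1 - \<alpha>) I q has_real_derivative g t) (at t within I)"
      by (rule deriv_cong) (rule eq[symmetric])
  qed
qed

text \<open>The right-hand side enters only through an equation for almost every \<open>t\<close>.
  \<open>N\<close> does not depend on \<open>x\<close>, so the alteration is harmless along every
  curve \<open>q\<close>.\<close>

lemma local_solution_cong_negligible:
  fixes f f' :: "(real ^ 'm) \<times> real \<Rightarrow> real ^ 'm"
  assumes N: "negligible N" and eq: "\<And>x t. t \<notin> N \<Longrightarrow> f (x, t) = f' (x, t)"
  shows "local_solution a J f = local_solution a J f'"
proof (intro ext)
  fix \<alpha> qa :: "real ^ 'm" and q :: "real \<Rightarrow> real ^ 'm" and I
  have "has_RL_deriv a (\<alpha> $ i) I (\<lambda>t. q t $ i - q a $ i) (\<lambda>t. f (q t, t) $ i) \<longleftrightarrow>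
      has_RL_deriv a (\<alpha> $ i) I (\<lambda>t. q t $ i - q a $ i) (\<lambda>t. f' (q t, t) $ i)"
    if "I \<in> intervals_from a" for i
    by (rule has_RL_deriv_cong_negligible[OF interval_lebesgue N]) (use that eq in \<open>auto simp: intervals_from_def\<close>)
  then show "local_solution a J f \<alpha> qa q I = local_solution a J f' \<alpha> qa q I"
    unfolding local_solution_def has_caputo_deriv_def by auto
qed

section \<open>Transfer to the given right-hand side\<close>

theorem theorem3:
  fixes a :: real and I\<^sub>f :: "real set"
    and f :: "(real ^ 'm) \<times> real \<Rightarrow> real ^ 'm"
    and q\<^sub>a \<alpha> :: "real ^ 'm"
  assumes "I\<^sub>f \<in> intervals_from a"
    and "caratheodory I\<^sub>f f"
    and "\<forall>i. 0 < \<alpha> $ i \<and> \<alpha> $ i \<le> 1"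
    and "\<forall>K c d. compact K \<and> {c..d} \<subseteq> I\<^sub>f \<longrightarrow>
           (\<exists>M\<ge>0. \<forall>x\<in>K. AE t in lebesgue_on {c..d}. norm (f (x, t)) \<le> M)"
    and "\<forall>c d. {c..d} \<subseteq> I\<^sub>f \<longrightarrow>
           (\<exists>L\<ge>0. \<forall>x\<^sub>1 x\<^sub>2. AE t in lebesgue_on {c..d}.
              norm (f (x\<^sub>2, t) - f (x\<^sub>1, t)) \<le> L * norm (x\<^sub>2 - x\<^sub>1))"
  shows "\<exists>q I. the_maximal_solution a I\<^sub>f f \<alpha> q\<^sub>a q I \<and> global_solution a I\<^sub>f f \<alpha> q\<^sub>a q I"
proof -
  obtain N where N: "negligible N"
    "\<And>b. b \<in> I\<^sub>f \<Longrightarrow> \<exists>L\<ge>0. \<forall>t\<in>{a..b} - N. \<forall>x y. norm (f (y, t) - f (x, t)) \<le> L * norm (y - x)"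
    "\<And>b. b \<in> I\<^sub>f \<Longrightarrow> \<exists>M\<ge>0. \<forall>t\<in>{a..b} - N. norm (f (0, t)) \<le> M"
    using exceptional_null_set[OF assms(1,2,4,5)] by blast
  \<comment> \<open>With the value 0 at exceptional times both estimates hold there trivially,
    because \<open>L\<close> and \<open>M\<close> are nonnegative.\<close>
  define f' where "f' = (\<lambda>(x, t). if t \<in> N then 0 else f (x, t))"
  interpret frac_cauchy_problem a "I\<^sub>f" f' \<alpha> "q\<^sub>a"
  proof
    show "I\<^sub>f \<in> intervals_from a" by (rule assms(1))
    show "0 < \<alpha> $ i" "\<alpha> $ i \<le> 1" for i using assms(3) by auto
    show "(\<lambda>t. f' (x, t)) \<in> borel_measurable (lebesgue_on I\<^sub>f)" for x
    proof -
      have "N \<in> sets lebesgue" using N(1) by (simp add: negligible_iff_null_sets null_setsD2)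
      then have "{t \<in> space (lebesgue_on I\<^sub>f). t \<in> N} \<in> sets (lebesgue_on I\<^sub>f)"
        by (auto simp: sets_restrict_space space_restrict_space Int_def)
      then show ?thesis
        using assms(2) unfolding f'_def caratheodory_def by (auto intro!: measurable_If)
    qed
    fix b assume b: "b \<in> I\<^sub>f"
    obtain L where L: "0 \<le> L" "\<And>t x y. t \<in> {a..b} - N \<Longrightarrow> norm (f (y, t) - f (x, t)) \<le> L * norm (y - x)"
      using N(2)[OF b] by blast
    then have "norm (f' (y, t) - f' (x, t)) \<le> L * norm (y - x)" if "t \<in> {a..b}" for t x y
      using that by (cases "t \<in> N") (simp_all add: f'_def)
    then show "\<exists>L\<ge>0. \<forall>t\<in>{a..b}. \<forall>x y. norm (f' (y, t) - f' (x, t)) \<le> L * norm (y - x)"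
      using L(1) by blast
    obtain M where M: "0 \<le> M" "\<And>t. t \<in> {a..b} - N \<Longrightarrow> norm (f (0, t)) \<le> M"
      using N(3)[OF b] by blast
    then have "norm (f' (0, t)) \<le> M" if "t \<in> {a..b}" for t
      using that by (cases "t \<in> N") (simp_all add: f'_def)
    then show "\<exists>M. \<forall>t\<in>{a..b}. norm (f' (0, t)) \<le> M" by blast
  qed
  have eq: "local_solution a I\<^sub>f f = local_solution a I\<^sub>f f'"
    by (rule local_solution_cong_negligible[OF N(1)]) (simp add: f'_def)
  \<comment> \<open>Extensions and maximality refer to the right-hand side only through
    \<open>local_solution\<close>, so the equality \<open>eq\<close> carries both notions
    over.\<close>
  have "the_maximal_solution a I\<^sub>f f \<alpha> q\<^sub>a picard_limit I\<^sub>f"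
    using picard_limit_maximal
    unfolding the_maximal_solution_def maximal_solution_def extends_solution_def eq .
  moreover have "global_solution a I\<^sub>f f \<alpha> q\<^sub>a picard_limit I\<^sub>f"
    using picard_limit_solution unfolding global_solution_def eq by simp
  ultimately show ?thesis by blast
qed

end
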